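(* Let $p_{\{3,3\}}(n)$ denote the number of $3$-regular partitions of $n$ in three colours, i.e. the integers defined by the formal power series identity $$\sum_{n=0}^{\infty}p_{\{3,3\}}(n)q^n=\prod_{j=1}^{\infty}\frac{(1-q^{3j})^3}{(1-q^{j})^3}.$$ Then for all integers $n\geq 0$, \begin{align*} p_{\{3,3\}}(15n+6)&\equiv 0 \pmod{5},\\ p_{\{3,3\}}(25n+6)&\equiv 0 \pmod{5},\\ p_{\{3,3\}}(25n+16)&\equiv 0 \pmod{5},\\ p_{\{3,3\}}(25n+21)&\equiv 0 \pmod{5}. \end{align*}
   Context: A partition of a positive integer $n$ is a non-increasing sequence of positive integers, called parts, whose sum is $n$. For a positive integer $\ell$, an $\ell$-regular partition is a partition none of whose parts is divisible by $\ell$. $p_{\{3,3\}}(n)$ is the number of $3$-regular partitions of $n$ in which each part may appear in any of three colours; its generating function is $f_3^3/f_1^3$, where $f_k=(q^k;q^k)_\infty=\prod_{j=1}^{\infty}(1-q^{jk})$ for a positive integer $k$. *)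

theory Defs
  imports
    "HOL-Analysis.Analysis"
    "HOL-Computational_Algebra.Formal_Power_Series"
    "HOL-Library.Multiset"
    "HOL-Number_Theory.Cong"
begin

text \<open>
  A partition in \<open>k\<close> colours is a finite multiset of pairs \<open>(j, c)\<close> consisting of a part \<open>j\<close>
  and its colour \<open>c < k\<close>. For \<open>n = 0\<close> only the empty multiset qualifies.
\<close>

definition regular_partitions :: "nat \<Rightarrow> nat \<Rightarrow> nat \<Rightarrow> (nat \<times> nat) multiset set" where
  "regular_partitions l k n =
     {M. (\<forall>(j, c) \<in># M. 0 < j \<and> \<not> l dvd j \<and> c < k) \<and> (\<Sum>(j, c) \<in># M. j) = n}"

definition p33 :: "nat \<Rightarrow> nat" where
  "p33 n = card (regular_partitions 3 3 n)"


text \<open>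
  The rest of this theory shows that the generating function of \<open>p33\<close> is
  $\prod_{j \ge 1} (1 - q^{3j})^3 / (1 - q^j)^3$ (theorem \<open>p33_generating_function\<close>), where the
  infinite product is taken in the \<open>q\<close>-adic topology of the ring of formal power series.
\<close>

definition parts_in :: "(nat \<times> nat) set \<Rightarrow> nat \<Rightarrow> (nat \<times> nat) multiset set" where
  "parts_in S n = {M. set_mset M \<subseteq> S \<and> (\<Sum>x \<in># M. fst x) = n}"

lemma size_le_sum_parts:
  fixes M :: "(nat \<times> nat) multiset"
  assumes "\<forall>x \<in># M. 0 < fst x"
  shows "size M \<le> (\<Sum>x \<in># M. fst x)"
  using assms
proof (induction M)
  case (add x M)
  then have "size M \<le> (\<Sum>x \<in># M. fst x)" "0 < fst x"
    by auto
  then show ?case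
    by simp
qed simp

lemma finite_parts_in:
  assumes "finite S" "\<forall>x \<in> S. 0 < fst x"
  shows "finite (parts_in S n)"
proof (rule finite_subset)
  show "parts_in S n \<subseteq> (\<Union>m\<le>n. multisets_of_size S m)"
  proof
    fix M assume M: "M \<in> parts_in S n"
    then have "size M \<le> n"
      using size_le_sum_parts[of M] assms(2) by (auto simp: parts_in_def)
    then show "M \<in> (\<Union>m\<le>n. multisets_of_size S m)"
      using M by (auto simp: parts_in_def multisets_of_size_def)
  qed
  show "finite (\<Union>m\<le>n. multisets_of_size S m)"
    using assms(1) by auto
qed

lemma parts_in_insert:
  assumes "s \<notin> S"
  shows "parts_in (insert s S) n =
           parts_in S n \<union> (if fst s \<le> n then add_mset s ` parts_in (insert s S) (n - fst s) else {})"
proof (intro equalityI subsetI)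
  fix M assume M: "M \<in> parts_in (insert s S) n"
  show "M \<in> parts_in S n \<union>
          (if fst s \<le> n then add_mset s ` parts_in (insert s S) (n - fst s) else {})"
  proof (cases "s \<in># M")
    case True
    then obtain M' where M': "M = add_mset s M'"
      by (meson mset_add)
    then show ?thesis
      using M by (auto simp: parts_in_def)
  next
    case False
    then show ?thesis
      using M by (auto simp: parts_in_def)
  qed
qed (use assms in \<open>auto simp: parts_in_def split: if_splits\<close>)

lemma card_parts_in_insert:
  assumes "finite S" "s \<notin> S" "\<forall>x \<in> insert s S. 0 < fst x"
  shows "card (parts_in (insert s S) n) =
           card (parts_in S n) + (if fst s \<le> n then card (parts_in (insert s S) (n - fst s)) else 0)"
proof -
  have "parts_in S n \<inter> add_mset s ` A = {}" for A
    using assms(2) by (auto simp: parts_in_def)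
  moreover have "card (add_mset s ` A) = card A" for A
    by (rule card_image) (auto simp: inj_on_def)
  moreover have "finite (parts_in S n)" "finite (parts_in (insert s S) m)" for m
    using assms by (auto intro!: finite_parts_in)
  ultimately show ?thesis
    by (subst parts_in_insert[OF assms(2)]) (auto simp: card_Un_disjoint)
qed

definition parts_gf :: "(nat \<times> nat) set \<Rightarrow> 'a :: field fps" where
  "parts_gf S = Abs_fps (\<lambda>n. of_nat (card (parts_in S n)))"

lemma parts_gf_mult:
  assumes "finite S" "\<forall>x \<in> S. 0 < fst x"
  shows "parts_gf S * (\<Prod>x\<in>S. 1 - fps_X ^ fst x) = (1 :: 'a :: field fps)"
  using assms
proof (induction S rule: finite_induct)
  case empty
  have "parts_in {} n = (if n = 0 then {{#}} else {})" for n
    by (auto simp: parts_in_def)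
  then show ?case
    by (auto simp: parts_gf_def fps_eq_iff)
next
  case (insert s S)
  have *: "parts_gf (insert s S) * (1 - fps_X ^ fst s) = (parts_gf S :: 'a fps)"
    using card_parts_in_insert[OF insert.hyps insert.prems]
    by (auto simp: fps_eq_iff parts_gf_def algebra_simps fps_X_power_mult_nth)
  show ?case
    unfolding prod.insert[OF insert.hyps] mult.assoc[symmetric] *
    using insert by blast
qed

lemma fps_X_power_dvd_prod:
  fixes f :: "'b \<Rightarrow> 'a :: comm_ring_1 fps"
  assumes "finite S" "\<forall>x \<in> S. fps_X ^ m dvd f x - 1"
  shows "fps_X ^ m dvd prod f S - 1"
  using assms
proof (induction S rule: finite_induct)
  case (insert x S)
  have eq: "prod f (insert x S) - 1 = (f x - 1) * prod f S + (prod f S - 1)"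
    using insert.hyps by (simp add: algebra_simps)
  have "fps_X ^ m dvd f x - 1" "fps_X ^ m dvd prod f S - 1"
    using insert by blast+
  then show ?case
    unfolding eq by (intro dvd_add dvd_mult2)
qed auto

lemma regular_partitions_eq_parts_in:
  assumes "n \<le> m"
  shows "regular_partitions l k n = parts_in ({j \<in> {1..m}. \<not> l dvd j} \<times> {..<k}) n"
proof -
  have le: "fst x \<le> (\<Sum>y \<in># M. fst y)" if "x \<in># M" for x and M :: "(nat \<times> nat) multiset"
    using that by (auto dest!: multi_member_split)
  have sum: "(\<Sum>(j, c) \<in># M. j) = (\<Sum>x \<in># M. fst x)" for M :: "(nat \<times> nat) multiset"
    by (simp add: case_prod_unfold)
  show ?thesis
  proof (intro equalityI subsetI)
    fix M assume "M \<in> regular_partitions l k n"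
    then have M: "\<forall>x \<in># M. 0 < fst x \<and> \<not> l dvd fst x \<and> snd x < k" "(\<Sum>x \<in># M. fst x) = n"
      by (auto simp: regular_partitions_def sum)
    have "x \<in> {j \<in> {1..m}. \<not> l dvd j} \<times> {..<k}" if "x \<in># M" for x
      using M(1) that le[OF that] M(2) assms by (cases x) auto
    then show "M \<in> parts_in ({j \<in> {1..m}. \<not> l dvd j} \<times> {..<k}) n"
      using M(2) by (auto simp: parts_in_def)
  next
    fix M assume "M \<in> parts_in ({j \<in> {1..m}. \<not> l dvd j} \<times> {..<k}) n"
    then show "M \<in> regular_partitions l k n"
      unfolding parts_in_def regular_partitions_def sum by fastforce
  qed
qed

theorem regular_partitions_generating_function:
  assumes "0 < l"
  shows "(\<lambda>i. (1 - fps_X ^ (l * Suc i)) ^ k / (1 - fps_X ^ Suc i) ^ k) has_prod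
           (Abs_fps (\<lambda>n. of_nat (card (regular_partitions l k n))) :: 'a :: field fps)"
    (is "?f has_prod ?P")
proof -
  let ?g = "\<lambda>j. 1 - fps_X ^ j :: 'a fps"
  have unit: "fps_nth (?g j) 0 \<noteq> 0" if "0 < j" for j
    using that by simp
  have nz: "?g j \<noteq> 0" if "0 < j" for j
    using unit[OF that] by (metis fps_zero_nth)
  have dvd1: "?g (Suc i) ^ k dvd ?g (l * Suc i) ^ k" for i
    by (rule dvd_power_same, rule unit_imp_dvd) (simp only: fps_is_unit_iff unit zero_less_Suc not_False_eq_True)
  have cancel: "c \<noteq> 0 \<Longrightarrow> t * (b * c) ^ k = (d * c) ^ k \<Longrightarrow> t * b ^ k = d ^ k" for b c d t :: "'a fps"
    by (simp add: power_mult_distrib mult.assoc[symmetric])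
  have "fps_nth (\<Prod>i\<le>N. ?f i) n = fps_nth ?P n" if "n \<le> N" for n N
  proof -
    let ?m = "Suc N"
    let ?B = "{j \<in> {1..?m}. \<not> l dvd j}"
    let ?C = "{j \<in> {1..?m}. l dvd j}"
    let ?D = "(*) l ` {1..?m}"
    let ?T = "\<Prod>i\<le>N. ?f i"
    let ?F = "parts_gf (?B \<times> {..<k}) :: 'a fps"
    define E where "E = prod ?g (?D - ?C) ^ k"
    have C_D: "?C \<subseteq> ?D"
    proof
      fix j assume "j \<in> ?C"
      then obtain i where i: "j = l * i" "1 \<le> j" "j \<le> ?m"
        by auto
      have "i \<le> j"
        using i(1) assms by simp
      moreover have "1 \<le> i"
        using i by (cases i) auto
      ultimately have "i \<in> {1..?m}"
        using i(3) by simp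
      then show "j \<in> ?D"
        unfolding i(1) by (rule imageI)
    qed
    have A: "(\<Prod>i\<le>N. ?g (Suc i)) = prod ?g ?B * prod ?g ?C"
    proof -
      have "(\<Prod>i\<le>N. ?g (Suc i)) = prod ?g {1..?m}"
        by (rule prod.reindex_bij_witness[of _ "\<lambda>j. j - 1" Suc]) auto
      also have "{1..?m} = ?B \<union> ?C"
        by auto
      also have "prod ?g (?B \<union> ?C) = prod ?g ?B * prod ?g ?C"
        by (rule prod.union_disjoint) auto
      finally show ?thesis .
    qed
    have D: "(\<Prod>i\<le>N. ?g (l * Suc i)) = prod ?g (?D - ?C) * prod ?g ?C"
    proof -
      have "prod ?g ?D = (\<Prod>j\<in>{1..?m}. ?g (l * j))"
        using assms by (subst prod.reindex) (auto simp: inj_on_def o_def)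
      also have "\<dots> = (\<Prod>i\<le>N. ?g (l * Suc i))"
        by (rule prod.reindex_bij_witness[of _ Suc "\<lambda>j. j - 1"]) auto
      finally show ?thesis
        using prod.subset_diff[OF C_D, of ?g] by simp
    qed
    have "?T * (\<Prod>i\<le>N. ?g (Suc i)) ^ k = (\<Prod>i\<le>N. ?f i * ?g (Suc i) ^ k)"
      by (simp only: prod.distrib prod_power_distrib)
    also have "\<dots> = (\<Prod>i\<le>N. ?g (l * Suc i)) ^ k"
      using dvd1 by (simp only: dvd_div_mult_self prod_power_distrib)
    finally have TA: "?T * (prod ?g ?B * prod ?g ?C) ^ k = (prod ?g (?D - ?C) * prod ?g ?C) ^ k"
      unfolding A D .
    have "prod ?g ?C \<noteq> 0"
    proof -
      have "\<not> (\<exists>j \<in> ?C. ?g j = 0)"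
        using nz by (metis (no_types, lifting) One_nat_def Suc_le_eq atLeastAtMost_iff mem_Collect_eq)
      moreover have "finite ?C"
        by simp
      ultimately show ?thesis
        by (simp only: prod_zero_iff not_False_eq_True)
    qed
    then have TB: "?T * prod ?g ?B ^ k = E"
      unfolding E_def using TA cancel by blast
    have F_fin: "finite (?B \<times> {..<k})" and F_pos: "\<forall>x \<in> ?B \<times> {..<k}. 0 < fst x"
      by auto
    have "(\<Prod>x\<in>?B \<times> {..<k}. ?g (fst x)) = (\<Prod>j\<in>?B. \<Prod>c<k. ?g j)"
      unfolding prod.cartesian_product case_prod_unfold ..
    also have "\<dots> = prod ?g ?B ^ k"
      by (simp only: prod_constant card_lessThan prod_power_distrib)
    finally have F: "?F * prod ?g ?B ^ k = 1"
      using parts_gf_mult[OF F_fin F_pos, where 'a = 'a] by (simp only:)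
    have "?T = ?T * (?F * prod ?g ?B ^ k)"
      unfolding F by (rule mult_1_right[symmetric])
    also have "\<dots> = ?F * E"
      unfolding TB[symmetric] by (rule mult.left_commute)
    finally have T: "?T - ?F = ?F * (E - 1)"
      by (simp only: right_diff_distrib mult_1_right)
    have "fps_X ^ ?m dvd ?g j - 1" if "j \<in> ?D - ?C" for j
    proof -
      have "?m \<le> j"
        using that assms by auto
      then have "fps_X ^ ?m dvd (fps_X ^ j :: 'a fps)"
        by (rule le_imp_power_dvd)
      then show ?thesis
        by simp
    qed
    then have "fps_X ^ ?m dvd prod ?g (?D - ?C) - 1"
      by (intro fps_X_power_dvd_prod ballI) simp
    then have "fps_X ^ ?m dvd E - 1"
      using fps_X_power_dvd_prod[of "{..<k}" ?m "\<lambda>_. prod ?g (?D - ?C)"]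
      by (simp only: E_def prod_constant card_lessThan finite_lessThan simp_thms Ball_def)
    then have "fps_X ^ ?m dvd ?T - ?F"
      unfolding T by (rule dvd_mult)
    then obtain h where "?T - ?F = fps_X ^ ?m * h"
      by (rule dvdE)
    then have "fps_nth (?T - ?F) n = 0"
      using that by (simp only: fps_X_power_mult_nth less_Suc_eq_le if_True)
    then show ?thesis
      using regular_partitions_eq_parts_in[of n ?m l k] that
      by (simp only: fps_sub_nth right_minus_eq parts_gf_def fps_nth_Abs_fps le_Suc_eq simp_thms)
  qed
  then have "(\<lambda>N. \<Prod>i\<le>N. ?f i) \<longlonglongrightarrow> ?P"
    by (intro tendsto_fpsI eventually_sequentiallyI)
  moreover have "?P \<noteq> 0"
  proof
    assume "?P = 0"
    then have "fps_nth ?P 0 = 0"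
      by simp
    moreover have "regular_partitions l k 0 = {{#}}"
      by (subst regular_partitions_eq_parts_in[of 0 0]) (auto simp: parts_in_def)
    ultimately show False
      by simp
  qed
  ultimately show ?thesis
    unfolding has_prod_def raw_has_prod_def add_0_right by blast
qed

theorem p33_generating_function:
  "Abs_fps (\<lambda>n. of_nat (p33 n)) =
     (\<Prod>i. (1 - fps_X ^ (3 * Suc i)) ^ 3 / (1 - fps_X ^ Suc i) ^ 3 :: 'a :: field fps)"
  unfolding p33_def by (rule has_prod_unique, rule regular_partitions_generating_function) simp

end

theory Submission
  imports Defs "HOL-Computational_Algebra.Polynomial"
begin

text \<open>
  Write $f_k = f(q^k)$ and $G = f_3^3 / f^3$ for the generating function. Modulo 5 we have
  $f^5 \equiv f_5$, so $G f_5 \equiv f^2 f_3^3$. By Euler's pentagonal number theorem and Jacobi's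
  identity, $f$ and $f^3$ are theta series, supported on the squares $24 n + 1$ and $8 n + 1$; the
  exponents of $f$ that are $1$ modulo $5$ make up $- q f_{25}$, and those of $f_3^3$ with
  coefficient prime to $5$ are $0$ or $3$ modulo $5$. Hence the coefficients $S(q)$ of $G$ at
  $5 m + 1$ satisfy $S f \equiv - 2 f_5 \, U(f f_3^3)$, where $U$ extracts the exponents divisible
  by $5$. The Gaussian integer identity $w^2 + 9 z^2 = 5 (u^2 + v^2)$ with $w = 2 u - v$ and
  $3 z = u + 2 v$ gives $U(f f_3^3) \equiv f P$, where $P = \sum \chi_4(v) v q^{(v^2 - 1)/24}$ over
  the $v > 0$ prime to $3$. So $S \equiv - 2 f_5 P$, and $P$ has no term prime to $5$ at exponents
  $1, 3, 4$ modulo $5$.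

  For the progression $15 n + 6$ split $f^3 = Q + W$ by whether $y$ with $y^2 = 8 n + 1$ is prime
  to $3$; the exponents of $Q$ are $0$ and those of $W$ are $1$ modulo $3$. An automorphism of the
  form $v^2 + 3 w^2$ yields $f_3 P = f (Q - 2 W)$, and therefore
  $f_3 S \equiv - 2 f^6 (Q - 2 W) = - 2 (Q^3 - 3 Q W^2 - 2 W^3)$, which has no exponent $1$ modulo $3$.
\<close>

section \<open>Truncated power series and the Euler product\<close>

lemma fps_X_power_dvd_iff:
  fixes A :: "'a :: comm_ring_1 fps"
  shows "fps_X ^ m dvd A \<longleftrightarrow> (\<forall>n<m. fps_nth A n = 0)"
proof
  assume "fps_X ^ m dvd A"
  then show "\<forall>n<m. fps_nth A n = 0"
    by (auto simp: fps_X_power_mult_nth elim!: dvdE)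
next
  assume *: "\<forall>n<m. fps_nth A n = 0"
  have "A = fps_X ^ m * Abs_fps (\<lambda>n. fps_nth A (n + m))"
    using * by (auto simp: fps_eq_iff fps_X_power_mult_nth)
  then show "fps_X ^ m dvd A"
    by (metis dvd_triv_left)
qed

text \<open>Once \<open>B\<close> vanishes below \<open>n\<close>, the only term left in coefficient
  \<open>n\<close> of \<open>A * B\<close> is the coefficient of \<open>B\<close> itself.\<close>

lemma fps_X_power_dvd_cancel:
  fixes A B :: "'a :: idom fps"
  assumes "fps_nth A 0 = 1" "fps_X ^ m dvd A * B"
  shows "fps_X ^ m dvd B"
  unfolding fps_X_power_dvd_iff
proof (intro allI impI)
  fix n assume "n < m"
  then show "fps_nth B n = 0"
  proof (induction n rule: less_induct)
    case (less n)
    have "fps_nth (A * B) n = (\<Sum>i=0..n. fps_nth A i * fps_nth B (n - i))"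
      by (rule fps_mult_nth)
    also have "\<dots> = (\<Sum>i\<in>{0}. fps_nth A i * fps_nth B (n - i))"
      using less by (intro sum.mono_neutral_right) auto
    finally show ?case
      using assms less.prems by (simp add: fps_X_power_dvd_iff)
  qed
qed

definition qpoch :: "nat \<Rightarrow> int fps" where
  "qpoch n = (\<Prod>i<n. 1 - fps_X ^ Suc i)"

text \<open>The coefficient of $q^n$ in $(q)_m$ is the same for all $m >= n$
  (\<open>qpoch_stable\<close>), so the diagonal is the infinite product $f$.\<close>

definition euler :: "int fps" where
  "euler = Abs_fps (\<lambda>n. fps_nth (qpoch n) n)"

lemma qpoch_0 [simp]: "qpoch 0 = 1"
  by (simp add: qpoch_def)

lemma qpoch_Suc: "qpoch (Suc n) = qpoch n * (1 - fps_X ^ Suc n)"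
  by (simp add: qpoch_def)

lemma qpoch_nth_0 [simp]: "fps_nth (qpoch n) 0 = 1"
  by (induction n) (auto simp: qpoch_Suc)

lemma qpoch_nonzero [simp]: "qpoch n \<noteq> 0"
  by (metis fps_zero_nth qpoch_nth_0 zero_neq_one)

lemma euler_nth_0 [simp]: "fps_nth euler 0 = 1"
  by (simp add: euler_def)

lemma qpoch_stable:
  assumes "m \<le> n"
  shows "fps_X ^ Suc m dvd qpoch n - qpoch m"
  using assms
proof (induction n rule: dec_induct)
  case (step n)
  have "fps_X ^ Suc m dvd qpoch n * fps_X ^ Suc n"
    using step by (intro dvd_mult le_imp_power_dvd) auto
  with step.IH have "fps_X ^ Suc m dvd (qpoch n - qpoch m) - qpoch n * fps_X ^ Suc n"
    by (rule dvd_diff)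
  then show ?case
    by (simp add: qpoch_Suc algebra_simps del: power_Suc)
qed auto

lemma euler_qpoch: "fps_X ^ Suc n dvd euler - qpoch n"
  unfolding fps_X_power_dvd_iff
proof (intro allI impI)
  fix m assume "m < Suc n"
  then have "fps_X ^ Suc m dvd qpoch n - qpoch m"
    by (intro qpoch_stable) auto
  then have "fps_nth (qpoch n - qpoch m) m = 0"
    unfolding fps_X_power_dvd_iff by blast
  then show "fps_nth (euler - qpoch n) m = 0"
    by (simp add: euler_def)
qed

definition tri :: "nat \<Rightarrow> nat" where
  "tri n = (\<Sum>i\<le>n. i)"

lemma tri_0 [simp]: "tri 0 = 0"
  and tri_Suc: "tri (Suc n) = tri n + Suc n"
  by (simp_all add: tri_def)

lemma two_tri: "2 * tri n = n * (n + 1)"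
  by (induction n) (auto simp: tri_Suc)

lemma tri_ge: "n \<le> tri n"
  by (cases n) (auto simp: tri_Suc)

section \<open>Euler's pentagonal number theorem\<close>

text \<open>The quotient $(q)_n / (q)_k$ for $k <= n$, written without division.\<close>

definition qtail :: "nat \<Rightarrow> nat \<Rightarrow> int fps" where
  "qtail k n = (\<Prod>i\<in>{k..<n}. 1 - fps_X ^ Suc i)"

lemma qtail_self [simp]: "qtail n n = 1"
  by (simp add: qtail_def)

lemma qtail_Suc: "k \<le> n \<Longrightarrow> qtail k (Suc n) = qtail k n * (1 - fps_X ^ Suc n)"
  by (simp add: qtail_def prod.atLeastLessThan_Suc)

lemma qtail_Suc_left: "k < n \<Longrightarrow> qtail k n = (1 - fps_X ^ Suc k) * qtail (Suc k) n"
  by (simp add: qtail_def prod.atLeast_Suc_lessThan)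

text \<open>
  Shanks' finite form of the theorem: the term $k = 0$ is $(q)_n$ and the others vanish to order
  greater than $n$, while the differences of consecutive sums telescope to two pentagonal powers.
\<close>

definition shanks :: "nat \<Rightarrow> int fps" where
  "shanks n = (\<Sum>k\<le>n. (-1) ^ k * qtail k n * fps_X ^ (k * n + tri k))"

lemma shanks_Suc:
  "shanks (Suc n) = shanks n + (-1) ^ Suc n *
     (fps_X ^ (Suc n * Suc n + tri n) + fps_X ^ (Suc n * Suc n + tri (Suc n)))"
proof -
  let ?X = "fps_X :: int fps"
  \<comment> \<open>Chosen so that summand \<open>k\<close> changes by
    \<open>h k - h (Suc k)\<close> when \<open>n\<close> becomes \<open>Suc n\<close>. As
    \<open>h 0 = 0\<close>, only \<open>- h (Suc n)\<close> survives the telescoping.\<close>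
  define h where "h j = (case j of 0 \<Rightarrow> 0 | Suc i \<Rightarrow>
      (-1) ^ i * qtail i n * ?X ^ (Suc i * Suc n + tri i))" for j
  have step: "(-1) ^ k * qtail k (Suc n) * ?X ^ (k * Suc n + tri k) =
      (-1) ^ k * qtail k n * ?X ^ (k * n + tri k) + (h k - h (Suc k))" if "k \<le> n" for k
  proof -
    have "?X ^ (k * Suc n + tri k) * (1 - ?X ^ Suc n) =
        ?X ^ (k * Suc n + tri k) - ?X ^ (Suc k * Suc n + tri k)"
      by (simp add: algebra_simps flip: power_add)
    then have 1: "(-1) ^ k * qtail k (Suc n) * ?X ^ (k * Suc n + tri k) =
      (-1) ^ k * qtail k n * ?X ^ (k * Suc n + tri k) - h (Suc k)"
      using qtail_Suc[OF that] by (simp add: h_def mult.assoc) (simp add: algebra_simps)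
    \<comment> \<open>Raising the exponent by \<open>k\<close> multiplies by $q^k = 1 - (1 - q^k)$,
      and the factor $1 - q^k$ extends the tail by one place to the left.\<close>
    have 2: "(-1) ^ k * qtail k n * ?X ^ (k * Suc n + tri k) =
      (-1) ^ k * qtail k n * ?X ^ (k * n + tri k) + h k"
    proof (cases k)
      case (Suc i)
      then have q: "qtail i n = (1 - ?X ^ k) * qtail k n"
        using that qtail_Suc_left[of i n] by simp
      have e: "Suc i * Suc n + tri i = k * n + tri k"
        by (simp add: Suc tri_Suc algebra_simps)
      have e': "k * Suc n + tri k = k + (k * n + tri k)"
        by simp
      have "h k = - ((-1) ^ k) * ((1 - ?X ^ k) * qtail k n) * ?X ^ (k * n + tri k)"
        unfolding q[symmetric] by (simp only: h_def Suc nat.case e[unfolded Suc]) simp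
      then show ?thesis
        unfolding e' power_add by (simp add: algebra_simps)
    qed (simp add: h_def)
    show ?thesis
      unfolding 1 2 by simp
  qed
  have "(\<Sum>k\<le>n. h k - h (Suc k)) = h 0 - h (Suc n)"
    by (rule sum_telescope)
  then have "(\<Sum>k\<le>n. (-1) ^ k * qtail k (Suc n) * ?X ^ (k * Suc n + tri k)) = shanks n - h (Suc n)"
    using step by (simp add: shanks_def sum.distrib h_def)
  \<comment> \<open>The two pentagonal powers are \<open>- h (Suc n)\<close> and the new summand at
    \<open>Suc n\<close>.\<close>
  then show ?thesis
    unfolding shanks_def[of "Suc n"] sum.atMost_Suc by (simp add: h_def algebra_simps)
qed

lemma shanks_qpoch: "fps_X ^ Suc n dvd shanks n - qpoch n"
proof -
  let ?g = "\<lambda>k. (-1) ^ k * qtail k n * fps_X ^ (k * n + tri k)"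
  have "shanks n = ?g 0 + sum ?g ({..n} - {0})"
    unfolding shanks_def by (subst sum.remove[of _ 0]) auto
  moreover have "?g 0 = qpoch n"
    by (simp add: qtail_def qpoch_def atLeast0LessThan)
  moreover have "fps_X ^ Suc n dvd sum ?g ({..n} - {0})"
  proof (rule dvd_sum)
    fix k assume "k \<in> {..n} - {0}"
    then have "1 * n \<le> k * n" "1 \<le> k"
      by (auto intro!: mult_le_mono1)
    then have "Suc n \<le> k * n + tri k"
      using tri_ge[of k] by linarith
    then show "fps_X ^ Suc n dvd ?g k"
      by (intro dvd_mult le_imp_power_dvd)
  qed
  ultimately show ?thesis
    by simp
qed

text \<open>With $K = N + 1$, the two powers added by \<open>shanks_Suc\<close> have exponents $K (3
  K - 1)/2$ and $K (3 K + 1)/2$, the generalised pentagonal numbers at $k = - K$ and $k =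
  K$.\<close>

lemma shanks_nth:
  "fps_nth (shanks N) n =
     (\<Sum>k\<in>{- int N..int N}. if k * (3 * k + 1) = 2 * int n then (-1) ^ nat \<bar>k\<bar> else 0)"
proof (induction N)
  case 0
  show ?case
    by (auto simp: shanks_def)
next
  case (Suc N)
  let ?g = "\<lambda>k. if k * (3 * k + 1) = 2 * int n then (-1) ^ nat \<bar>k\<bar> else (0 :: int)"
  let ?k = "int (Suc N)"
  have set: "{- ?k..?k} = insert ?k (insert (- ?k) {- int N..int N})"
    by auto
  have t: "2 * int (tri N) = int N * (int N + 1)"
    using two_tri[of N] by (metis of_nat_1 of_nat_add of_nat_mult of_nat_numeral)
  have e1: "n = Suc N * Suc N + tri N \<longleftrightarrow> (- ?k) * (3 * (- ?k) + 1) = 2 * int n"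
  proof -
    have "n = Suc N * Suc N + tri N \<longleftrightarrow> 2 * int n = 2 * int (Suc N * Suc N + tri N)"
      by (simp only: mult_cancel_left of_nat_eq_iff) simp
    also have "2 * int (Suc N * Suc N + tri N) = (- ?k) * (3 * (- ?k) + 1)"
      using t by (simp add: algebra_simps)
    finally show ?thesis
      by metis
  qed
  have e2: "n = Suc N * Suc N + tri (Suc N) \<longleftrightarrow> ?k * (3 * ?k + 1) = 2 * int n"
  proof -
    have "n = Suc N * Suc N + tri (Suc N) \<longleftrightarrow> 2 * int n = 2 * int (Suc N * Suc N + tri (Suc N))"
      by (simp only: mult_cancel_left of_nat_eq_iff) simp
    also have "2 * int (Suc N * Suc N + tri (Suc N)) = ?k * (3 * ?k + 1)"
      using t by (simp add: algebra_simps tri_Suc)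
    finally show ?thesis
      by metis
  qed
  have "fps_nth (shanks (Suc N)) n = fps_nth (shanks N) n + (-1) ^ Suc N *
      ((if n = Suc N * Suc N + tri N then 1 else 0) + (if n = Suc N * Suc N + tri (Suc N) then 1 else 0))"
  proof -
    have "fps_nth ((-1) ^ m * A) n = (-1) ^ m * fps_nth A n" for m and A :: "int fps"
      by (cases "even m") auto
    then show ?thesis
      by (simp only: shanks_Suc fps_add_nth fps_X_power_nth)
  qed
  also have "\<dots> = sum ?g {- int N..int N} + ?g ?k + ?g (- ?k)"
    unfolding Suc e1 e2 by (simp add: nat_add_distrib)
  also have "\<dots> = sum ?g {- ?k..?k}"
    unfolding set by (subst sum.insert; simp)+
  finally show ?case .
qed

section \<open>Jacobi's identity for the cube\<close>

text \<open>Gaussian binomial coefficients through the $q$-Pascal rule, which avoids dividing by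
  $(q)_k (q)_{n-k}$.\<close>

fun qbin :: "nat \<Rightarrow> nat \<Rightarrow> int fps" where
  "qbin n 0 = 1"
| "qbin 0 (Suc k) = 0"
| "qbin (Suc n) (Suc k) = qbin n k + fps_X ^ Suc k * qbin n (Suc k)"

lemma qbin_eq_0: "n < k \<Longrightarrow> qbin n k = 0"
  by (induction n k rule: qbin.induct) auto

lemma qbin_self [simp]: "qbin n n = 1"
  by (induction n) (auto simp: qbin_eq_0)

text \<open>The two terms of the Pascal rule contribute the factors $1 - q^k$ and $q^k (1 - q^n)$,
  which add up to $1 - q^{n+k}$.\<close>

lemma qbin_qpoch: "qbin (n + k) k * (qpoch n * qpoch k) = qpoch (n + k)"
proof (induction "n + k" arbitrary: n k rule: less_induct)
  case less
  show ?case
  proof (cases n; cases k)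
    fix n' k' assume n: "n = Suc n'" and k: "k = Suc k'"
    have 1: "qbin (Suc (n' + k')) k' * (qpoch (Suc n') * qpoch k') = qpoch (Suc (n' + k'))"
      using less[of "Suc n'" k'] n k by simp
    have 2: "qbin (Suc (n' + k')) (Suc k') * (qpoch n' * qpoch (Suc k')) = qpoch (Suc (n' + k'))"
      using less[of n' "Suc k'"] n k by simp
    have "qbin (n + k) k * (qpoch n * qpoch k) =
        (qbin (Suc (n' + k')) k' + fps_X ^ Suc k' * qbin (Suc (n' + k')) (Suc k')) *
        (qpoch (Suc n') * qpoch (Suc k'))"
      by (simp add: n k)
    also have "\<dots> = (1 - fps_X ^ Suc k') * (qbin (Suc (n' + k')) k' * (qpoch (Suc n') * qpoch k')) +
        fps_X ^ Suc k' * (1 - fps_X ^ Suc n') *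
          (qbin (Suc (n' + k')) (Suc k') * (qpoch n' * qpoch (Suc k')))"
      by (simp only: qpoch_Suc) (simp only: algebra_simps)
    also have "\<dots> = (1 - fps_X ^ (Suc k' + Suc n')) * qpoch (Suc (n' + k'))"
      unfolding 1 2 power_add by (simp only: algebra_simps mult_1_left)
    also have "\<dots> = qpoch (n + k)"
      by (simp only: n k qpoch_Suc[of "Suc (n' + k')"] add_Suc add_Suc_right add.commute[of k' n'] mult.commute)
    finally show ?thesis .
  qed auto
qed

lemma qbin_symmetric: "qbin (n + k) k = qbin (n + k) n"
proof -
  have "qbin (n + k) k * (qpoch n * qpoch k) = qbin (n + k) n * (qpoch n * qpoch k)"
    using qbin_qpoch[of n k] qbin_qpoch[of k n] by (simp add: ac_simps)
  then show ?thesis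
    by simp
qed

text \<open>The variables are polynomials over the power series, so that the identity can later be
  differentiated. Peeling off the factor $i = 0$ replaces $z$ by $q z$ in the others, hence the
  induction over arbitrary \<open>z\<close>.\<close>

lemma q_binomial_theorem:
  fixes y z :: "int fps poly"
  shows "(\<Prod>i<n. y + [:fps_X ^ i:] * z) =
           (\<Sum>k\<le>n. [:fps_X ^ tri (k - 1) * qbin n k:] * z ^ k * y ^ (n - k))"
proof (induction n arbitrary: z)
  case (Suc n)
  let ?X = "\<lambda>i. [:fps_X ^ i:] :: int fps poly"
  let ?c = "\<lambda>k. [:fps_X ^ tri (k - 1) * qbin n k:]"
  let ?z = "?X 1 * z"
  have pw: "?z ^ k = ?X k * z ^ k" for k
    by (simp only: power_mult_distrib poly_const_pow power_mult[symmetric] mult_1_left)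
  have "(\<Prod>i<Suc n. y + ?X i * z) = (y + z) * (\<Prod>i<n. y + ?X (Suc i) * z)"
    by (simp add: prod.lessThan_Suc_shift del: prod.lessThan_Suc flip: one_pCons)
  also have "(\<Prod>i<n. y + ?X (Suc i) * z) = (\<Prod>i<n. y + ?X i * ?z)"
    by (intro prod.cong) (auto simp: mult.commute)
  also have "\<dots> = (\<Sum>k\<le>n. ?c k * ?z ^ k * y ^ (n - k))"
    by (rule Suc)
  also have "\<dots> = (\<Sum>k\<le>n. ?c k * ?X k * z ^ k * y ^ (n - k))"
    unfolding pw by (simp only: mult.assoc)
  also have "(y + z) * \<dots> = (\<Sum>k\<le>n. ?c k * ?X k * z ^ k * y ^ (Suc n - k)) +
      (\<Sum>k\<le>n. ?c k * ?X k * z ^ Suc k * y ^ (n - k))"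
    unfolding distrib_right[of y z] unfolding sum_distrib_left
    by (intro arg_cong2[where f = "(+)"] sum.cong) (auto simp: Suc_diff_le algebra_simps)
  also have "(\<Sum>k\<le>n. ?c k * ?X k * z ^ k * y ^ (Suc n - k)) =
      (\<Sum>k\<le>Suc n. ?c k * ?X k * z ^ k * y ^ (Suc n - k))"
    by (simp add: qbin_eq_0)
  also have "\<dots> = y ^ Suc n + (\<Sum>k\<le>n. ?c (Suc k) * ?X (Suc k) * z ^ Suc k * y ^ (n - k))"
    by (subst sum.atMost_Suc_shift) (simp add: tri_def flip: one_pCons)
  also have "\<dots> + (\<Sum>k\<le>n. ?c k * ?X k * z ^ Suc k * y ^ (n - k)) = y ^ Suc n +
     (\<Sum>k\<le>n. [:fps_X ^ tri k * qbin (Suc n) (Suc k):] * z ^ Suc k * y ^ (n - k))"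
  proof -
    \<comment> \<open>The case split on \<open>k\<close> is due to truncated subtraction: at 0,
      \<open>tri (k - 1)\<close> is \<open>tri 0\<close>, which is the correct exponent 0.\<close>
    have "?c (Suc k) * ?X (Suc k) + ?c k * ?X k = [:fps_X ^ tri k * qbin (Suc n) (Suc k):]" for k
      by (cases k) (simp_all add: algebra_simps tri_Suc power_add)
    then show ?thesis
      unfolding add.assoc sum.distrib[symmetric] distrib_right[symmetric] by (simp only:)
  qed
  also have "\<dots> = (\<Sum>k\<le>Suc n. [:fps_X ^ tri (k - 1) * qbin (Suc n) k:] * z ^ k * y ^ (Suc n - k))"
    by (subst sum.atMost_Suc_shift) (simp add: tri_def flip: one_pCons)
  finally show ?case .
qed (simp add: tri_def flip: one_pCons)

lemma prod_lessThan_add: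
  fixes g :: "nat \<Rightarrow> 'a :: comm_monoid_mult"
  shows "(\<Prod>i<m + n. g i) = (\<Prod>i<m. g i) * (\<Prod>i<n. g (m + i))"
  by (induction n) (auto simp: ac_simps)

text \<open>Extracting $- q^i$ from each factor leaves $1 - q^{n-i}$, that is, $(q)_n$ in reverse
  order. The extra factor $q^n$ completes the exponent $0 + ... + (n - 1)$ to
  \<open>tri n\<close>.\<close>

lemma prod_fps_X_diff:
  "fps_X ^ n * (\<Prod>i<n. fps_X ^ n - fps_X ^ i) = (-1) ^ n * fps_X ^ tri n * qpoch n"
proof -
  have "(fps_X :: int fps) ^ n - fps_X ^ i = - (fps_X ^ i) * (1 - fps_X ^ Suc (n - Suc i))" if "i < n" for i
    using that by (simp add: algebra_simps Suc_diff_Suc del: power_Suc flip: power_add)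
  then have "(\<Prod>i<n. (fps_X :: int fps) ^ n - fps_X ^ i) =
      (\<Prod>i<n. - (fps_X ^ i) * (1 - fps_X ^ Suc (n - Suc i)))"
    by (intro prod.cong) auto
  also have "\<dots> = (\<Prod>i<n. - (fps_X ^ i)) * (\<Prod>i<n. 1 - fps_X ^ Suc (n - Suc i))"
    by (rule prod.distrib)
  also have "(\<Prod>i<n. 1 - fps_X ^ Suc (n - Suc i)) = qpoch n"
    unfolding qpoch_def by (rule prod.nat_diff_reindex)
  also have "fps_X ^ n * ((\<Prod>i<n. - (fps_X ^ i)) * qpoch n) =
      (fps_X ^ n * (\<Prod>i<n. - (fps_X ^ i))) * qpoch n"
    by (simp only: mult.assoc)
  also have "fps_X ^ n * (\<Prod>i<n. - (fps_X ^ i :: int fps)) = (-1) ^ n * fps_X ^ tri n"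
  proof (induction n)
    case (Suc n)
    have "fps_X ^ Suc n * (\<Prod>i<Suc n. - (fps_X ^ i :: int fps)) =
        - (fps_X ^ Suc n * (fps_X ^ n * (\<Prod>i<n. - (fps_X ^ i :: int fps))))"
      by (simp add: ac_simps)
    then show ?case
      unfolding Suc by (simp add: tri_Suc power_add ac_simps)
  qed simp
  finally show ?thesis .
qed

text \<open>
  Put $y = q^n$ and $z = - t$ in the $q$-binomial theorem for $2 n + 1$ factors and differentiate
  at $t = 1$: only the factor $q^n - t q^n$ vanishes there. The summands $n - j$ and $n + 1 + j$
  carry the same power of $q$ and combine to the coefficient $2 j + 1$.
\<close>

lemma qpoch_square:
  "qpoch n ^ 2 = (\<Sum>j\<le>n. (-1) ^ j * of_nat (2 * j + 1) * fps_X ^ tri j * qbin (2 * n + 1) (n - j))"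
    (is "_ = ?S")
proof -
  let ?N = "2 * n + 1"
  let ?X = "fps_X :: int fps"
  let ?y = "[:?X ^ n:]" and ?z = "[:0, -1:] :: int fps poly"
  define g where "g i = ?y + [:?X ^ i:] * ?z" for i
  \<comment> \<open>\<open>F k\<close> is the derivative at $t = 1$ of summand \<open>k\<close> in
    the binomial expansion.\<close>
  define F where "F k = of_nat k * (?X ^ tri (k - 1) * qbin ?N k * (-1) ^ k * ?X ^ (n * (?N - k)))" for k
  have g: "g i = [:?X ^ n, - (?X ^ i):]" for i
    by (simp add: g_def)
  define R where "R = (\<Prod>i<n. g i) * (\<Prod>i<n. g (Suc n + i))"
  have P: "(\<Prod>i<?N. g i) = g n * R"
  proof -
    have "?N = n + Suc n"
      by simp
    then have "(\<Prod>i<?N. g i) = (\<Prod>i<n. g i) * (\<Prod>i<Suc n. g (n + i))"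
      by (simp only: prod_lessThan_add)
    also have "(\<Prod>i<Suc n. g (n + i)) = g n * (\<Prod>i<n. g (Suc n + i))"
      unfolding prod.lessThan_Suc_shift by simp
    finally show ?thesis
      by (simp add: R_def ac_simps)
  qed
  have R1: "?X ^ n * poly R 1 = (-1) ^ n * ?X ^ (n * n + tri n) * qpoch n ^ 2"
  proof -
    have "(\<Prod>i<n. ?X ^ n - ?X ^ (Suc n + i)) = (\<Prod>i<n. ?X ^ n * (1 - ?X ^ Suc i))"
      by (intro prod.cong) (simp_all add: algebra_simps power_add)
    also have "\<dots> = ?X ^ (n * n) * qpoch n"
      by (simp only: prod.distrib qpoch_def prod_constant card_lessThan power_mult)
    finally have "?X ^ n * poly R 1 = (?X ^ n * (\<Prod>i<n. ?X ^ n - ?X ^ i)) * (?X ^ (n * n) * qpoch n)"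
      by (simp add: R_def g poly_prod ac_simps)
    then show ?thesis
      unfolding prod_fps_X_diff by (simp add: power_add power2_eq_square ac_simps)
  qed
  have "poly (pderiv (g n * R)) 1 = - (?X ^ n * poly R 1)"
  proof -
    have "poly (g n) 1 = 0" "poly (pderiv (g n)) 1 = - (?X ^ n)"
      by (simp_all add: g pderiv_pCons)
    then show ?thesis
      by (simp add: pderiv_mult)
  qed
  moreover have "poly (pderiv (g n * R)) 1 = (\<Sum>k\<le>?N. F k)"
  proof -
    have "[:c:] * ?z ^ k * ?y ^ m = monom (c * (-1) ^ k * ?X ^ (n * m)) k" for c k m
    proof -
      have "?z ^ k = monom ((-1) ^ k) k"
        by (induction k) (auto simp: monom_Suc minus_monom)
      then show ?thesis
        by (simp add: poly_const_pow smult_monom ac_simps flip: power_mult)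
    qed
    then have "g n * R = (\<Sum>k\<le>?N. monom (?X ^ tri (k - 1) * qbin ?N k * (-1) ^ k * ?X ^ (n * (?N - k))) k)"
      unfolding P[symmetric] unfolding g_def q_binomial_theorem by (simp only:)
    then show ?thesis
      by (simp only: higher_pderiv_sum[where n = 1, simplified] pderiv_monom poly_sum poly_monom F_def power_one mult_1_right)
  qed
  moreover have "(\<Sum>k\<le>?N. F k) = (\<Sum>j\<le>n. F (n - j) + F (Suc n + j))"
  proof -
    have "(\<Sum>k\<le>?N. F k) = (\<Sum>k\<in>{..n} \<union> {Suc n..?N}. F k)"
      by (rule arg_cong[where f = "sum F"]) auto
    also have "\<dots> = (\<Sum>k\<le>n. F k) + (\<Sum>k\<in>{Suc n..?N}. F k)"
      by (rule sum.union_disjoint) auto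
    also have "(\<Sum>k\<le>n. F k) = (\<Sum>j\<le>n. F (n - j))"
      by (rule sum.reindex_bij_witness[of _ "\<lambda>j. n - j" "\<lambda>j. n - j"]) auto
    also have "(\<Sum>k\<in>{Suc n..?N}. F k) = (\<Sum>j\<le>n. F (Suc n + j))"
      by (rule sum.reindex_bij_witness[of _ "\<lambda>j. Suc n + j" "\<lambda>k. k - Suc n"]) auto
    finally show ?thesis
      by (simp add: sum.distrib)
  qed
  moreover have "F (n - j) + F (Suc n + j) = - ((-1) ^ n * ?X ^ (n * n + tri n)) *
      ((-1) ^ j * of_nat (2 * j + 1) * ?X ^ tri j * qbin ?N (n - j))" if "j \<le> n" for j
  proof -
    \<comment> \<open>Both summands have the exponent $n^2 + tri(n) + tri(j)$. For $j = n$ the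
      truncated \<open>n - j - 1\<close> is 0, as wanted.\<close>
    have e1: "tri (n - j - 1) + n * (?N - (n - j)) = n * n + tri n + tri j"
    proof (cases "n - j")
      case 0
      then show ?thesis
        using that two_tri[of n] by (simp add: algebra_simps)
    next
      case (Suc d)
      then have n: "n = Suc (d + j)"
        using that by simp
      have "2 * (tri d + n * (n + 1 + j)) = 2 * (n * n + tri n + tri j)"
        using two_tri[of n] two_tri[of d] two_tri[of j] unfolding n by (simp add: algebra_simps)
      moreover have "?N - (n - j) = n + 1 + j"
        using that by simp
      ultimately show ?thesis
        using Suc by simp
    qed
    have e2: "tri (Suc n + j - 1) + n * (?N - (Suc n + j)) = n * n + tri n + tri j"
    proof -
      obtain d where n: "n = j + d"
        using le_Suc_ex[OF \<open>j \<le> n\<close>] by blast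
      have "2 * (tri (n + j) + n * d) = 2 * (n * n + tri n + tri j)"
        using two_tri[of n] two_tri[of "n + j"] two_tri[of j] unfolding n by (simp add: algebra_simps)
      then show ?thesis
        using n by simp
    qed
    have sym: "qbin ?N (Suc n + j) = qbin ?N (n - j)"
    proof -
      have "n - j + (Suc n + j) = ?N"
        using that by simp
      then show ?thesis
        using qbin_symmetric[of "n - j" "Suc n + j"] by (simp only:)
    qed
    have s1: "(-1) ^ (n - j) = ((-1) ^ n * (-1) ^ j :: int fps)"
    proof -
      obtain d where "n = j + d"
        using le_Suc_ex[OF \<open>j \<le> n\<close>] by blast
      then show ?thesis
        by (simp add: power_add mult.assoc)
    qed
    have F1: "F (n - j) = of_nat (n - j) * ((-1) ^ n * (-1) ^ j * ?X ^ (n * n + tri n + tri j) * qbin ?N (n - j))"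
      unfolding F_def e1[symmetric] power_add s1 by (simp only: ac_simps)
    have F2: "F (Suc n + j) = - (of_nat (Suc n + j) * ((-1) ^ n * (-1) ^ j * ?X ^ (n * n + tri n + tri j) * qbin ?N (n - j)))"
    proof -
      have "(-1) ^ (Suc n + j) = - ((-1) ^ n * (-1) ^ j :: int fps)"
        by (simp add: power_add)
      then show ?thesis
        unfolding F_def e2[symmetric] power_add[of ?X "tri _"] sym
        by (simp only: ac_simps mult_minus_left mult_minus_right)
    qed
    have o: "of_nat (n - j) = (of_nat n - of_nat j :: int fps)"
      using that by (rule of_nat_diff)
    \<comment> \<open>The weights $n - j$ and $- (n + 1 + j)$ add up to $- (2 j + 1)$.\<close>
    show ?thesis
      unfolding F1 F2 o power_add by (simp add: algebra_simps)
  qed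
  ultimately have "(-1) ^ n * ?X ^ (n * n + tri n) * qpoch n ^ 2 = (-1) ^ n * ?X ^ (n * n + tri n) * ?S"
    unfolding R1 by (simp add: sum_distrib_left[symmetric] sum_negf)
  then show ?thesis
    by simp
qed

text \<open>The Gaussian binomial $b$ tends to $1/f$: in $b (q)_{n+1+j} (q)_{n-j} = (q)_{2n+1}$ all
  three products agree with $f$ up to $q^{n-j}$. This gives $f (f b - 1)$ the required order, and
  $f$ cancels.\<close>

lemma euler_qbin:
  assumes "j \<le> n"
  shows "fps_X ^ Suc (n - j) dvd euler * qbin (2 * n + 1) (n - j) - 1"
proof (rule fps_X_power_dvd_cancel)
  let ?b = "qbin (2 * n + 1) (n - j)" and ?m = "n - j"
  let ?p = "qpoch (Suc n + j)" and ?q = "qpoch (n - j)" and ?r = "qpoch (2 * n + 1)"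
  have eq: "fps_X ^ Suc ?m dvd euler - qpoch a" if "?m \<le> a" for a
    using that by (intro dvd_trans[OF le_imp_power_dvd euler_qpoch]) auto
  have "?b * (?p * ?q) = ?r"
    using qbin_qpoch[of "Suc n + j" "n - j"] assms by (simp add: mult_2)
  then have "euler * (euler * ?b - 1) = ?b * ((euler - ?p) * euler + ?p * (euler - ?q)) - (euler - ?r)"
    by (simp add: algebra_simps)
  moreover have "fps_X ^ Suc ?m dvd \<dots>"
    by (intro dvd_diff dvd_mult dvd_add dvd_mult2 eq) auto
  ultimately show "fps_X ^ Suc ?m dvd euler * (euler * ?b - 1)"
    by simp
qed simp

text \<open>Multiply \<open>qpoch_square\<close> by $f$ and replace each product of $f$ with a
  Gaussian binomial by 1. The error starts only at order $n - j + 1$, but the factor $q^{tri(j)}$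
  makes up for the missing $j$.\<close>

lemma euler_cube:
  "fps_X ^ Suc n dvd euler ^ 3 - (\<Sum>j\<le>n. (-1) ^ j * of_nat (2 * j + 1) * fps_X ^ tri j)"
proof -
  let ?c = "\<lambda>j. (-1) ^ j * of_nat (2 * j + 1) :: int fps"
  let ?b = "\<lambda>j. qbin (2 * n + 1) (n - j)"
  have "euler ^ 3 - (\<Sum>j\<le>n. ?c j * fps_X ^ tri j) =
      euler * ((euler - qpoch n) * (euler + qpoch n)) +
      (euler * qpoch n ^ 2 - (\<Sum>j\<le>n. ?c j * fps_X ^ tri j))"
    by (simp add: algebra_simps power3_eq_cube power2_eq_square)
  also have "euler * qpoch n ^ 2 - (\<Sum>j\<le>n. ?c j * fps_X ^ tri j) =
      (\<Sum>j\<le>n. ?c j * (fps_X ^ tri j * (euler * ?b j - 1)))"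
    unfolding qpoch_square sum_distrib_left sum_subtractf[symmetric]
    by (intro sum.cong) (simp_all only: algebra_simps mult_1_left)
  finally have *: "euler ^ 3 - (\<Sum>j\<le>n. ?c j * fps_X ^ tri j) =
      euler * ((euler - qpoch n) * (euler + qpoch n)) +
      (\<Sum>j\<le>n. ?c j * (fps_X ^ tri j * (euler * ?b j - 1)))" .
  have "fps_X ^ Suc n dvd fps_X ^ tri j * (euler * ?b j - 1)" if "j \<le> n" for j
  proof -
    have "Suc n \<le> tri j + Suc (n - j)"
      using tri_ge[of j] that by linarith
    then have "fps_X ^ Suc n dvd (fps_X ^ (tri j + Suc (n - j)) :: int fps)"
      by (rule le_imp_power_dvd)
    also have "\<dots> dvd fps_X ^ tri j * (euler * ?b j - 1)"
      unfolding power_add by (intro mult_dvd_mono dvd_refl euler_qbin that)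
    finally show ?thesis .
  qed
  then show ?thesis
    unfolding * by (intro dvd_add dvd_sum dvd_mult[OF dvd_mult2[OF euler_qpoch]] dvd_mult[of "fps_X ^ Suc n" "_ * _"])
      (simp_all only: atMost_iff)
qed

lemma euler_cube_nth:
  "fps_nth (euler ^ 3) n = (\<Sum>j\<le>n. if tri j = n then (-1) ^ j * (2 * int j + 1) else 0)"
proof -
  have "fps_nth ((-1) ^ j * of_nat m * fps_X ^ k :: int fps) n = (if k = n then (-1) ^ j * int m else 0)"
    for j m k
    by (cases "even j") (auto simp: fps_X_power_nth fps_of_nat[symmetric])
  moreover have "fps_nth (euler ^ 3 - (\<Sum>j\<le>n. (-1) ^ j * of_nat (2 * j + 1) * fps_X ^ tri j)) n = 0"
    using euler_cube[of n] unfolding fps_X_power_dvd_iff by blast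
  ultimately show ?thesis
    by (simp only: fps_sub_nth fps_sum_nth right_minus_eq) (intro sum.cong; simp)
qed

section \<open>Theta series\<close>

text \<open>The nonprincipal characters modulo 3 and, below, modulo 4. Their product is the even
  character modulo 12 that gives the signs in Euler's theorem.\<close>

definition chi3 :: "int \<Rightarrow> int" where
  "chi3 n = (if n mod 3 = 1 then 1 else if n mod 3 = 2 then -1 else 0)"

definition chi4 :: "int \<Rightarrow> int" where
  "chi4 n = (if n mod 4 = 1 then 1 else if n mod 4 = 3 then -1 else 0)"

definition theta_set :: "int \<Rightarrow> nat \<Rightarrow> int set" where
  "theta_set k n = {w. k * w\<^sup>2 = 24 * int n + k}"

text \<open>
  \<open>theta k a\<close> is $\sum a(w) q^{k (w^2 - 1)/24}$ over all integers $w$ of either sign, so that even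
  weights count every exponent twice. Terms with a non-integral or negative exponent are dropped,
  which is why \<open>theta_mult_nth\<close> restricts the supports.
\<close>

definition theta :: "int \<Rightarrow> (int \<Rightarrow> int) \<Rightarrow> int fps" where
  "theta k a = Abs_fps (\<lambda>n. \<Sum>w\<in>theta_set k n. a w)"

lemma chi3_minus: "chi3 (- n) = - chi3 n"
  by (auto simp: chi3_def zmod_zminus1_eq_if)

lemma chi4_minus: "chi4 (- n) = - chi4 n"
  by (auto simp: chi4_def zmod_zminus1_eq_if)

lemma chi4_nz: "chi4 v \<noteq> 0 \<Longrightarrow> odd v"
  unfolding chi4_def by presburger

lemma chi3_nz: "chi3 v \<noteq> 0 \<longleftrightarrow> \<not> 3 dvd v"
  unfolding chi3_def by presburger

lemma chi4_cong: "4 dvd x - y \<Longrightarrow> chi4 x = chi4 y"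
  unfolding chi4_def by (simp add: mod_eq_dvd_iff[symmetric])

lemma chi3_cong: "3 dvd x - y \<Longrightarrow> chi3 x = chi3 y"
  unfolding chi3_def by (simp add: mod_eq_dvd_iff[symmetric])

text \<open>Adding $2 r$ with $r$ odd exchanges the classes 1 and 3 modulo 4.\<close>

lemma chi4_mult_add:
  assumes "odd v" "odd r"
  shows "chi4 v * chi4 (v + 2 * r) = - 1"
proof -
  obtain s where r: "r = 2 * s + 1"
    using assms(2) by (rule oddE)
  have "chi4 (v + 2 * r) = chi4 (v + 2)"
    by (rule chi4_cong) (simp add: r)
  moreover obtain t where v: "v = 2 * t + 1"
    using assms(1) by (rule oddE)
  moreover have "chi4 (2 * t + 1) * chi4 (2 * t + 1 + 2) = - 1"
  proof (cases "even t")
    case True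
    then obtain u where "t = 2 * u"
      by (rule evenE)
    then show ?thesis
      by (simp add: chi4_def)
  next
    case False
    then obtain u where t: "t = 2 * u + 1"
      by (rule oddE)
    have "chi4 (2 * t + 1) = chi4 3" "chi4 (2 * t + 1 + 2) = chi4 1"
      by (rule chi4_cong; simp add: t)+
    then show ?thesis
      by (simp add: chi4_def)
  qed
  ultimately show ?thesis
    by simp
qed

lemma abs_le_square: "\<bar>w\<bar> \<le> w\<^sup>2" for w :: int
proof (cases "w = 0")
  case False
  then have "\<bar>w\<bar> * 1 \<le> \<bar>w\<bar> * \<bar>w\<bar>"
    by (intro mult_left_mono) auto
  then show ?thesis
    by (simp add: power2_eq_square)
qed simp

lemma finite_int_square_le: "finite {w :: int. w\<^sup>2 \<le> m}"
proof (rule finite_subset)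
  show "{w. w\<^sup>2 \<le> m} \<subseteq> {- m..m}"
  proof
    fix w assume "w \<in> {w. w\<^sup>2 \<le> m}"
    then show "w \<in> {- m..m}"
      using abs_le_square[of w] by (simp add: abs_le_iff)
  qed
qed simp

lemma finite_theta_set:
  assumes "0 < k"
  shows "finite (theta_set k n)"
proof (rule finite_subset[OF _ finite_int_square_le])
  show "theta_set k n \<subseteq> {w. w\<^sup>2 \<le> 24 * int n + k}"
  proof
    fix w assume w: "w \<in> theta_set k n"
    have "1 * w\<^sup>2 \<le> k * w\<^sup>2"
      using assms by (intro mult_right_mono) auto
    then show "w \<in> {w. w\<^sup>2 \<le> 24 * int n + k}"
      using w by (simp add: theta_set_def)
  qed
qed

lemma uminus_theta_set: "- w \<in> theta_set k n \<longleftrightarrow> w \<in> theta_set k n"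
  by (simp add: theta_set_def)

lemma fps_numeral_mult_nth: "fps_nth (numeral k * A) n = numeral k * fps_nth A n" for A :: "int fps"
  by (simp add: numeral_fps_const)

text \<open>Completing the square turns $n = k (3 k + 1)/2$ into $24 n + 1 = w^2$ with $w = 6 k +
  1$, where \<open>chi3\<close> is 1 and \<open>chi4\<close> is $(-1)^k$. The class 5 modulo 6 is
  the mirror image under $w -> - w$, whence the factor 2.\<close>

lemma two_euler: "2 * euler = theta 1 (\<lambda>w. chi4 w * chi3 w)"
proof (rule fps_ext)
  fix n
  let ?S = "theta_set 1 n" and ?a = "\<lambda>w. chi4 w * chi3 w"
  let ?A = "{w \<in> ?S. w mod 6 = 1}" and ?B = "{w \<in> ?S. w mod 6 = 5}"
  let ?K = "{k \<in> {- int n..int n}. k * (3 * k + 1) = 2 * int n}"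
  have "sum ?a ?S = sum ?a (?A \<union> ?B)"
  proof (rule sum.mono_neutral_right)
    show "\<forall>w\<in>?S - (?A \<union> ?B). ?a w = 0"
    proof
      fix w assume "w \<in> ?S - (?A \<union> ?B)"
      then have "w mod 6 \<noteq> 1" "w mod 6 \<noteq> 5"
        by auto
      moreover have "w mod 6 = 1 \<or> w mod 6 = 5" if "odd w" "\<not> 3 dvd w"
        using that by presburger
      ultimately show "?a w = 0"
        using chi4_nz[of w] chi3_nz[of w] by auto
    qed
  qed (auto intro: finite_theta_set)
  also have "\<dots> = sum ?a ?A + sum ?a ?B"
    by (rule sum.union_disjoint) (auto intro: finite_subset[OF _ finite_theta_set[of _ n]])
  also have "sum ?a ?B = sum ?a ?A"
  proof (rule sum.reindex_bij_witness[of _ uminus uminus])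
    show "- w \<in> ?A" if "w \<in> ?B" for w
    proof -
      have "w mod 6 = 5 \<Longrightarrow> (- w) mod 6 = 1"
        by (simp add: zmod_zminus1_eq_if)
      then show ?thesis
        using that by (simp add: uminus_theta_set)
    qed
    show "- w \<in> ?B" if "w \<in> ?A" for w
    proof -
      have "w mod 6 = 1 \<Longrightarrow> (- w) mod 6 = 5"
        by (simp add: zmod_zminus1_eq_if)
      then show ?thesis
        using that by (simp add: uminus_theta_set)
    qed
  qed (simp_all add: chi3_minus chi4_minus)
  also have "sum ?a ?A = (\<Sum>k\<in>?K. (-1) ^ nat \<bar>k\<bar>)"
  proof (rule sum.reindex_bij_witness[of _ "\<lambda>k. 6 * k + 1" "\<lambda>w. w div 6"])
    fix w assume w: "w \<in> ?A"
    then have w6: "6 * (w div 6) + 1 = w"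
      using mult_div_mod_eq[of 6 w] by simp
    then show "6 * (w div 6) + 1 = w" .
    define k where "k = w div 6"
    have wk: "w = 6 * k + 1"
      using w6 by (simp add: k_def)
    have "(6 * k + 1)\<^sup>2 = 24 * int n + 1"
      using w by (simp add: theta_set_def wk)
    then have k2: "3 * k\<^sup>2 + k = 2 * int n"
      by (simp add: power2_eq_square algebra_simps)
    then have "\<bar>k\<bar> \<le> int n"
      using abs_le_square[of k] by linarith
    then show "w div 6 \<in> ?K"
      using k2 unfolding k_def[symmetric] by (simp add: abs_le_iff power2_eq_square algebra_simps)
    have "chi3 w = chi3 1"
      by (rule chi3_cong) (simp add: wk)
    moreover have "chi4 w = chi4 (if even k then 1 else 3)"
      by (rule chi4_cong) (use wk in presburger)
    ultimately have "chi3 w = 1" "chi4 w = (if even k then 1 else -1)"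
      by (simp_all add: chi3_def chi4_def)
    then show "(-1) ^ nat \<bar>w div 6\<bar> = ?a w"
      unfolding k_def[symmetric] by (simp add: even_nat_iff)
  next
    fix k assume k: "k \<in> ?K"
    show "(6 * k + 1) div 6 = k"
      by simp
    have "(6 * k + 1)\<^sup>2 = 12 * (k * (3 * k + 1)) + 1"
      by (simp add: power2_eq_square algebra_simps)
    then show "6 * k + 1 \<in> ?A"
      using k by (simp add: theta_set_def)
  qed
  also have "\<dots> = fps_nth (shanks n) n"
    unfolding shanks_nth by (rule sum.inter_filter) simp
  also have "\<dots> = fps_nth euler n"
    using shanks_qpoch[of n] unfolding fps_X_power_dvd_iff by (simp add: euler_def)
  finally show "fps_nth (2 * euler) n = fps_nth (theta 1 ?a) n"
    by (simp add: theta_def fps_numeral_mult_nth)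
qed

text \<open>The odd number $w = 2 j + 1$ satisfies $w^2 = 8 n + 1$ exactly when
  \<open>tri j = n\<close>. The weight is even in $w$, so negative $w$ double the sum.\<close>

lemma two_euler_cube: "2 * euler ^ 3 = theta 3 (\<lambda>y. chi4 y * y)"
proof (rule fps_ext)
  fix n
  let ?S = "theta_set 3 n" and ?a = "\<lambda>y. chi4 y * y"
  let ?A = "{w \<in> ?S. 0 < w}" and ?B = "{w \<in> ?S. w < 0}"
  let ?J = "{j \<in> {..n}. tri j = n}"
  have S: "w \<in> ?S \<longleftrightarrow> w\<^sup>2 = 8 * int n + 1" for w
    by (auto simp: theta_set_def)
  have "?S = ?A \<union> ?B"
    by (auto simp: S) (metis S less_linear zero_power2 add.right_neutral add_pos_nonneg mult_nonneg_nonneg of_nat_0_le_iff zero_le_numeral zero_less_one add.commute less_irrefl)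
  then have "sum ?a ?S = sum ?a (?A \<union> ?B)"
    by simp
  also have "\<dots> = sum ?a ?A + sum ?a ?B"
    by (rule sum.union_disjoint) (auto intro: finite_subset[OF _ finite_theta_set[of _ n]])
  also have "sum ?a ?B = sum ?a ?A"
    by (rule sum.reindex_bij_witness[of _ uminus uminus]) (simp_all add: uminus_theta_set chi4_minus)
  also have "sum ?a ?A = (\<Sum>j\<in>?J. (-1) ^ j * (2 * int j + 1))"
  proof (rule sum.reindex_bij_witness[of _ "\<lambda>j. 2 * int j + 1" "\<lambda>w. nat (w div 2)"])
    fix w assume w: "w \<in> ?A"
    then have "odd (w\<^sup>2)"
      by (simp add: S)
    then have "odd w"
      by simp
    define j where "j = nat (w div 2)"
    have wj: "w = 2 * int j + 1"
      using w \<open>odd w\<close> by (auto simp: j_def elim!: oddE)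
    then show "2 * int (nat (w div 2)) + 1 = w"
      by (simp add: j_def)
    have "(2 * int j + 1)\<^sup>2 = 8 * int n + 1"
      using w by (simp add: S wj)
    then have "int j + int j * int j = 2 * int n"
      by (simp add: power2_eq_square algebra_simps)
    then have "int (j * (j + 1)) = int (2 * n)"
      by (simp add: algebra_simps)
    then have "tri j = n"
      unfolding of_nat_eq_iff two_tri[symmetric] by simp
    then show "nat (w div 2) \<in> ?J"
      unfolding j_def[symmetric] using tri_ge[of j] by simp
    have "chi4 w = chi4 (if even j then 1 else 3)"
      by (rule chi4_cong) (use wj in presburger)
    then have "chi4 w = (if even j then 1 else -1)"
      by (simp add: chi4_def)
    then show "(-1) ^ nat (w div 2) * (2 * int (nat (w div 2)) + 1) = ?a w"
      unfolding j_def[symmetric] by (simp add: wj)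
  next
    fix j assume j: "j \<in> ?J"
    show "nat ((2 * int j + 1) div 2) = j"
      by simp
    have "int (j * (j + 1)) = int (2 * n)"
      using two_tri[of j] j by simp
    then have "(2 * int j + 1)\<^sup>2 = 8 * int n + 1"
      by (simp add: power2_eq_square algebra_simps)
    then show "2 * int j + 1 \<in> ?A"
      by (simp add: S)
  qed
  also have "\<dots> = fps_nth (euler ^ 3) n"
    unfolding euler_cube_nth by (rule sum.inter_filter) simp
  finally show "fps_nth (2 * euler ^ 3) n = fps_nth (theta 3 ?a) n"
    by (simp add: theta_def fps_numeral_mult_nth)
qed

lemma finite_quadratic_set:
  fixes k l m :: int
  assumes "0 < k" "0 < l"
  shows "finite {(v, w). k * v\<^sup>2 + l * w\<^sup>2 = m}"
proof (rule finite_subset)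
  let ?Q = "{w :: int. w\<^sup>2 \<le> m}"
  show "{(v, w). k * v\<^sup>2 + l * w\<^sup>2 = m} \<subseteq> ?Q \<times> ?Q"
  proof (rule subrelI)
    fix v w assume "(v, w) \<in> {(v, w). k * v\<^sup>2 + l * w\<^sup>2 = m}"
    then have *: "k * v\<^sup>2 + l * w\<^sup>2 = m"
      by simp
    have "1 * v\<^sup>2 \<le> k * v\<^sup>2" "1 * w\<^sup>2 \<le> l * w\<^sup>2" "0 \<le> v\<^sup>2" "0 \<le> w\<^sup>2"
      using assms by (simp_all only: mult_right_mono zero_le_power2 int_one_le_iff_zero_less)
    then have "v\<^sup>2 \<le> m" "w\<^sup>2 \<le> m"
      using * by linarith+
    then show "(v, w) \<in> ?Q \<times> ?Q"
      by simp
  qed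
qed (auto intro: finite_int_square_le)

text \<open>A pair solving the combined equation comes from a factorisation $q^i q^{n-i}$ once both
  exponents are natural numbers. Divisibility by 24 makes them integers, and nonzero arguments make
  them nonnegative.\<close>

lemma theta_mult_nth:
  assumes "0 < k" "0 < l"
    and a: "\<And>v. a v \<noteq> 0 \<Longrightarrow> v \<noteq> 0 \<and> 24 dvd k * (v\<^sup>2 - 1)"
    and b: "\<And>w. b w \<noteq> 0 \<Longrightarrow> w \<noteq> 0 \<and> 24 dvd l * (w\<^sup>2 - 1)"
  shows "fps_nth (theta k a * theta l b) n =
     (\<Sum>(v, w) | k * v\<^sup>2 + l * w\<^sup>2 = 24 * int n + k + l. a v * b w)"
proof -
  let ?f = "\<lambda>(v, w). a v * b w"
  let ?S = "{(v, w). k * v\<^sup>2 + l * w\<^sup>2 = 24 * int n + k + l}"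
  let ?T = "\<lambda>i. theta_set k i \<times> theta_set l (n - i)"
  have "fps_nth (theta k a * theta l b) n =
      (\<Sum>i=0..n. (\<Sum>v\<in>theta_set k i. a v) * (\<Sum>w\<in>theta_set l (n - i). b w))"
    by (simp add: fps_mult_nth theta_def)
  also have "\<dots> = (\<Sum>i=0..n. \<Sum>p\<in>?T i. ?f p)"
    by (simp only: sum_product sum.cartesian_product)
  also have "\<dots> = (\<Sum>p\<in>(\<Union>i\<in>{0..n}. ?T i). ?f p)"
  proof (rule sum.UNION_disjoint[symmetric])
    show "\<forall>i\<in>{0..n}. finite (?T i)"
      using assms(1,2) by (auto intro: finite_theta_set)
    show "\<forall>i\<in>{0..n}. \<forall>j\<in>{0..n}. i \<noteq> j \<longrightarrow> ?T i \<inter> ?T j = {}"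
      by (auto simp: theta_set_def)
  qed simp
  also have "\<dots> = (\<Sum>p\<in>?S. ?f p)"
  proof (rule sum.mono_neutral_left[OF finite_quadratic_set[OF assms(1,2)]])
    show "(\<Union>i\<in>{0..n}. ?T i) \<subseteq> ?S"
      by (auto simp: theta_set_def of_nat_diff)
    show "\<forall>p\<in>?S - (\<Union>i\<in>{0..n}. ?T i). ?f p = 0"
    proof (intro ballI, rule ccontr)
      fix p assume p: "p \<in> ?S - (\<Union>i\<in>{0..n}. ?T i)" and nz: "?f p \<noteq> 0"
      obtain v w where vw: "p = (v, w)"
        by fastforce
      have eq: "k * v\<^sup>2 + l * w\<^sup>2 = 24 * int n + k + l"
        using p vw by auto
      have v: "v \<noteq> 0" "24 dvd k * (v\<^sup>2 - 1)" and w: "w \<noteq> 0"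
        using a[of v] b[of w] nz vw by auto
      have ge: "0 \<le> c * (x\<^sup>2 - 1)" if "x \<noteq> 0" "0 < c" for x c :: int
      proof -
        have "0 < x\<^sup>2"
          using that by simp
        then show ?thesis
          using that by (intro mult_nonneg_nonneg) auto
      qed
      obtain i' where i': "k * (v\<^sup>2 - 1) = 24 * i'"
        using v(2) by (rule dvdE)
      define i where "i = nat i'"
      have i: "k * (v\<^sup>2 - 1) = 24 * int i"
        using i' ge[OF v(1) assms(1)] by (simp add: i_def)
      have "l * (w\<^sup>2 - 1) = 24 * (int n - int i)"
        using eq i by (simp add: algebra_simps)
      moreover from this have "i \<le> n"
        using ge[OF w assms(2)] by simp
      ultimately have "p \<in> ?T i" "i \<in> {0..n}"
        using i by (auto simp: vw theta_set_def of_nat_diff algebra_simps)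
      then show False
        using p by blast
    qed
  qed
  finally show ?thesis
    by (simp add: case_prod_unfold)
qed

section \<open>Dissections and congruences modulo 5\<close>

definition dil :: "nat \<Rightarrow> int fps \<Rightarrow> int fps" where
  "dil k A = A oo fps_X ^ k"

definition sec :: "nat \<Rightarrow> nat \<Rightarrow> int fps \<Rightarrow> int fps" where
  "sec d r A = Abs_fps (\<lambda>n. fps_nth A (d * n + r))"

lemma dil_nth:
  assumes "0 < k"
  shows "fps_nth (dil k A) n = (if k dvd n then fps_nth A (n div k) else 0)"
proof -
  have "fps_nth (dil k A) n = (\<Sum>i=0..n. if n = k * i then fps_nth A i else 0)"
    by (auto simp: dil_def fps_compose_nth fps_X_power_nth simp flip: power_mult intro!: sum.cong)
  also have "\<dots> = (\<Sum>i\<in>{i \<in> {0..n}. n = k * i}. fps_nth A i)"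
    by (rule sum.inter_filter[symmetric]) simp
  also have "{i \<in> {0..n}. n = k * i} = (if k dvd n then {n div k} else {})"
    using assms by (auto simp: le_trans[OF div_le_dividend])
  finally show ?thesis
    by simp
qed

lemma dil_mult: "0 < k \<Longrightarrow> dil k (A * B) = dil k A * dil k B"
  by (simp add: dil_def fps_compose_mult_distrib)

lemma dil_power: "0 < k \<Longrightarrow> dil k (A ^ n) = dil k A ^ n"
  by (simp add: dil_def fps_compose_power)

lemma dil_diff: "dil k (A - B) = dil k A - dil k B"
  by (simp add: dil_def fps_compose_sub_distrib)

lemma dil_dil: "0 < k \<Longrightarrow> 0 < l \<Longrightarrow> dil k (dil l A) = dil (k * l) A"
  by (auto simp: fps_eq_iff dil_nth div_mult2_eq elim!: dvdE)

lemma dil_dvd: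
  assumes "0 < k" "fps_X ^ m dvd A"
  shows "fps_X ^ (k * m) dvd dil k A"
  using assms by (auto simp: fps_X_power_dvd_iff dil_nth elim!: dvdE)

lemma sec_nth [simp]: "fps_nth (sec d r A) n = fps_nth A (d * n + r)"
  by (simp add: sec_def)

lemma sec_add: "sec d r (A + B) = sec d r A + sec d r B"
  by (simp add: fps_eq_iff)

text \<open>A factor in $q^d$ does not move residue classes modulo $d$, so it leaves the extraction
  with $q^d$ replaced by $q$.\<close>

lemma sec_mult_dil:
  assumes "r < d"
  shows "sec d r (A * dil d B) = sec d r A * B"
proof (rule fps_ext)
  fix n
  have "fps_nth (sec d r (A * dil d B)) n =
      (\<Sum>i=0..d * n + r. fps_nth (dil d B) i * fps_nth A (d * n + r - i))"
    by (simp add: mult.commute[of A] fps_mult_nth)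
  also have "\<dots> = (\<Sum>i\<in>(*) d ` {0..n}. fps_nth (dil d B) i * fps_nth A (d * n + r - i))"
  proof (rule sum.mono_neutral_right)
    show "(*) d ` {0..n} \<subseteq> {0..d * n + r}"
      by (auto intro!: trans_le_add1)
    show "\<forall>i\<in>{0..d * n + r} - (*) d ` {0..n}. fps_nth (dil d B) i * fps_nth A (d * n + r - i) = 0"
    proof
      fix i assume i: "i \<in> {0..d * n + r} - (*) d ` {0..n}"
      have "\<not> d dvd i"
      proof
        assume "d dvd i"
        then obtain j where j: "i = d * j"
          by (rule dvdE)
        then have "d * j < d * (n + 1)"
          using i assms by simp
        then have "j \<le> n"
          by (simp only: mult_less_cancel1) simp
        then have "i \<in> (*) d ` {0..n}"
          unfolding j by (intro imageI) simp
        then show False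
          using i by blast
      qed
      then show "fps_nth (dil d B) i * fps_nth A (d * n + r - i) = 0"
        using assms by (simp add: dil_nth)
    qed
  qed simp
  also have "\<dots> = (\<Sum>j=0..n. fps_nth B j * fps_nth A (d * (n - j) + r))"
  proof -
    have "inj_on ((*) d) {0..n}"
      using assms by (auto simp: inj_on_def)
    then show ?thesis
      using assms by (auto simp: sum.reindex dil_nth diff_mult_distrib2 intro!: sum.cong)
  qed
  also have "\<dots> = fps_nth (sec d r A * B) n"
    by (simp add: mult.commute[of _ B] fps_mult_nth)
  finally show "fps_nth (sec d r (A * dil d B)) n = fps_nth (sec d r A * B) n" .
qed

section \<open>Congruence and supports modulo 5\<close>

definition cong5 :: "int fps \<Rightarrow> int fps \<Rightarrow> bool" where
  "cong5 A B \<longleftrightarrow> (5 :: int fps) dvd A - B"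

lemma five_dvd_fps_iff: "(5 :: int fps) dvd A \<longleftrightarrow> (\<forall>n. 5 dvd fps_nth A n)"
proof
  assume "\<forall>n. 5 dvd fps_nth A n"
  then have "A = 5 * Abs_fps (\<lambda>n. fps_nth A n div 5)"
    by (simp add: fps_eq_iff fps_numeral_mult_nth)
  then show "5 dvd A"
    by (metis dvd_triv_left)
qed (auto simp: fps_numeral_mult_nth elim!: dvdE)

lemma cong5_refl [simp]: "cong5 A A"
  by (simp add: cong5_def)

lemma cong5_sym: "cong5 A B \<Longrightarrow> cong5 B A"
  unfolding cong5_def by (subst dvd_minus_iff[symmetric]) simp

lemma cong5_trans [trans]: "cong5 A B \<Longrightarrow> cong5 B C \<Longrightarrow> cong5 A C"
  unfolding cong5_def using dvd_add by fastforce

lemma cong5_add: "cong5 A B \<Longrightarrow> cong5 C D \<Longrightarrow> cong5 (A + C) (B + D)"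
  unfolding cong5_def add_diff_add by (rule dvd_add)

lemma cong5_mult: "cong5 A B \<Longrightarrow> cong5 C D \<Longrightarrow> cong5 (A * C) (B * D)"
proof -
  assume "cong5 A B" "cong5 C D"
  then have "5 dvd (A - B) * C + B * (C - D)"
    unfolding cong5_def by (intro dvd_add dvd_mult dvd_mult2)
  then show ?thesis
    by (simp add: cong5_def algebra_simps)
qed

lemma cong5_nth: "cong5 A B \<Longrightarrow> 5 dvd fps_nth A n - fps_nth B n"
  by (simp add: cong5_def five_dvd_fps_iff)

lemma cong5_sec: "cong5 A B \<Longrightarrow> cong5 (sec d r A) (sec d r B)"
  by (simp add: cong5_def five_dvd_fps_iff)

text \<open>\<open>F\<close> is a unit: coefficient \<open>n\<close> of \<open>F * (A - B)\<close>
  is that of \<open>A - B\<close> plus earlier coefficients already divisible by 5.\<close>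

lemma cong5_cancel:
  assumes "fps_nth F 0 = 1" "cong5 (A * F) (B * F)"
  shows "cong5 A B"
proof -
  have dvd: "5 dvd fps_nth (F * (A - B)) n" for n
    using assms(2) by (simp add: cong5_def five_dvd_fps_iff algebra_simps)
  have "5 dvd fps_nth (A - B) n" for n
  proof (induction n rule: less_induct)
    case (less n)
    have "fps_nth (F * (A - B)) n = (\<Sum>i=0..n. fps_nth F i * fps_nth (A - B) (n - i))"
      by (rule fps_mult_nth)
    also have "\<dots> = fps_nth (A - B) n + (\<Sum>i\<in>{0..n} - {0}. fps_nth F i * fps_nth (A - B) (n - i))"
      using assms(1) by (subst sum.remove[of _ 0]) auto
    finally have eq: "fps_nth (F * (A - B)) n =
        fps_nth (A - B) n + (\<Sum>i\<in>{0..n} - {0}. fps_nth F i * fps_nth (A - B) (n - i))" .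
    have "5 dvd (\<Sum>i\<in>{0..n} - {0}. fps_nth F i * fps_nth (A - B) (n - i))"
      using less by (intro dvd_sum dvd_mult) auto
    then show ?case
      using dvd[of n] unfolding eq by (simp only: dvd_add_left_iff)
  qed
  then show ?thesis
    unfolding cong5_def five_dvd_fps_iff by blast
qed

text \<open>With \<open>d = 5\<close> this is support modulo 5; with \<open>d = 0\<close> it is
  exact support, since 0 divides only 0. One calculus thus serves both dissections.\<close>

definition supp_mod :: "int \<Rightarrow> nat \<Rightarrow> nat set \<Rightarrow> int fps \<Rightarrow> bool" where
  "supp_mod d m S A \<longleftrightarrow> (\<forall>n. n mod m \<notin> S \<longrightarrow> d dvd fps_nth A n)"

lemma supp_modD: "supp_mod d m S A \<Longrightarrow> n mod m \<notin> S \<Longrightarrow> d dvd fps_nth A n"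
  by (simp add: supp_mod_def)

lemma supp_mod_mult:
  assumes "supp_mod d m S A" "supp_mod d m T B" "\<And>s t. s \<in> S \<Longrightarrow> t \<in> T \<Longrightarrow> (s + t) mod m \<in> U"
  shows "supp_mod d m U (A * B)"
  unfolding supp_mod_def
proof (intro allI impI)
  fix n assume n: "n mod m \<notin> U"
  have "d dvd fps_nth A i * fps_nth B (n - i)" if "i \<le> n" for i
  proof (cases "i mod m \<in> S \<and> (n - i) mod m \<in> T")
    case True
    then have "(i mod m + (n - i) mod m) mod m \<in> U"
      using assms(3) by blast
    then show ?thesis
      using n that by (simp add: mod_add_eq)
  next
    case False
    then show ?thesis
      using assms(1,2) by (auto simp: supp_mod_def)
  qed
  then show "d dvd fps_nth (A * B) n"
    unfolding fps_mult_nth by (intro dvd_sum) auto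
qed

lemma supp_mod_add:
  "supp_mod d m S A \<Longrightarrow> supp_mod d m T B \<Longrightarrow> S \<union> T \<subseteq> U \<Longrightarrow> supp_mod d m U (A + B)"
  by (auto simp: supp_mod_def intro!: dvd_add)

lemma supp_mod_cmult: "supp_mod d m S A \<Longrightarrow> supp_mod d m S (numeral k * A)"
  by (auto simp: supp_mod_def fps_numeral_mult_nth)

lemma supp_mod_minus: "supp_mod d m S A \<Longrightarrow> supp_mod d m S (- A)"
  by (auto simp: supp_mod_def)

lemma supp_mod_dil: "0 < k \<Longrightarrow> m dvd k \<Longrightarrow> supp_mod d m {0} (dil k A)"
  by (auto simp: supp_mod_def dil_nth intro: dvd_trans)

lemma supp_mod_fps_X: "1 < m \<Longrightarrow> supp_mod d m {1} fps_X"
  by (auto simp: supp_mod_def fps_X_def)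

lemma cong5_sec_0:
  assumes "supp_mod 5 d S A" "r \<notin> S" "r < d"
  shows "cong5 (sec d r A) 0"
  using assms by (auto simp: cong5_def five_dvd_fps_iff intro!: supp_modD)

text \<open>Frobenius, applied to each factor of the finite products: $(1 - x)^5$ and $1 - x^5$
  agree modulo 5. Coefficient \<open>n\<close> of either side sees only
  \<open>qpoch n\<close>.\<close>

lemma euler_power_5: "cong5 (euler ^ 5) (dil 5 euler)"
proof -
  have q: "cong5 (qpoch n ^ 5) (dil 5 (qpoch n))" for n
  proof (induction n)
    case 0
    show ?case
      by (simp add: dil_def)
  next
    case (Suc n)
    let ?x = "fps_X ^ Suc n :: int fps"
    have "(1 - ?x) ^ 5 - (1 - ?x ^ 5) = 5 * (- ?x + 2 * ?x ^ 2 - 2 * ?x ^ 3 + ?x ^ 4)"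
      by algebra
    moreover have "dil 5 (1 - ?x) = 1 - ?x ^ 5"
      by (simp add: dil_def fps_compose_sub_distrib mult.commute flip: fps_compose_power power_Suc power_mult)
    ultimately have "cong5 ((1 - ?x) ^ 5) (dil 5 (1 - ?x))"
      by (simp only: cong5_def dvd_triv_left)
    with Suc show ?case
      by (simp only: qpoch_Suc power_mult_distrib dil_mult zero_less_numeral cong5_mult)
  qed
  have "5 dvd fps_nth (euler ^ 5 - dil 5 euler) n" for n
  proof -
    have "fps_X ^ Suc n dvd euler ^ 5 - qpoch n ^ 5"
    proof -
      have "euler ^ 5 - qpoch n ^ 5 = (euler - qpoch n) *
          (euler ^ 4 + euler ^ 3 * qpoch n + euler ^ 2 * qpoch n ^ 2 + euler * qpoch n ^ 3 + qpoch n ^ 4)"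
        by algebra
      then show ?thesis
        using euler_qpoch[of n] by (simp only: dvd_mult2)
    qed
    then have 1: "fps_nth (euler ^ 5) n = fps_nth (qpoch n ^ 5) n"
      unfolding fps_X_power_dvd_iff by simp
    have "fps_X ^ (5 * Suc n) dvd dil 5 euler - dil 5 (qpoch n)"
      unfolding dil_diff[symmetric] by (intro dil_dvd euler_qpoch) simp
    then have 2: "fps_nth (dil 5 euler) n = fps_nth (dil 5 (qpoch n)) n"
      unfolding fps_X_power_dvd_iff by simp
    show ?thesis
      using q[of n] 1 2 by (simp add: cong5_def five_dvd_fps_iff)
  qed
  then show ?thesis
    unfolding cong5_def five_dvd_fps_iff by blast
qed

section \<open>The generating function\<close>

definition p33_gf :: "int fps" where
  "p33_gf = Abs_fps (\<lambda>n. int (p33 n))"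

text \<open>The integral counterpart of \<open>parts_gf_mult\<close>: over a field such as the
  rationals, divisibility by 5 would say nothing.\<close>

lemma parts_gf_int_mult:
  assumes "finite S" "\<forall>x\<in>S. 0 < fst x"
  shows "Abs_fps (\<lambda>n. int (card (parts_in S n))) * (\<Prod>x\<in>S. 1 - fps_X ^ fst x) = 1"
  using assms
proof (induction S rule: finite_induct)
  case empty
  have "parts_in {} n = (if n = 0 then {{#}} else {})" for n
    by (auto simp: parts_in_def)
  then show ?case
    by (auto simp: fps_eq_iff)
next
  case (insert s S)
  have "Abs_fps (\<lambda>n. int (card (parts_in (insert s S) n))) * (1 - fps_X ^ fst s) =
      Abs_fps (\<lambda>n. int (card (parts_in S n)))"
    using card_parts_in_insert[OF insert.hyps insert.prems]
    by (auto simp: fps_eq_iff algebra_simps fps_X_power_mult_nth)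
  then show ?case
    unfolding prod.insert[OF insert.hyps] mult.assoc[symmetric] using insert by simp
qed

lemma qpoch_split:
  "qpoch m = (\<Prod>j | j \<in> {1..m} \<and> \<not> 3 dvd j. 1 - fps_X ^ j) * dil 3 (qpoch (m div 3))"
proof -
  let ?g = "\<lambda>j. 1 - fps_X ^ j :: int fps"
  let ?B = "{j. j \<in> {1..m} \<and> \<not> 3 dvd j}" and ?C = "{j. j \<in> {1..m} \<and> 3 dvd j}"
  have "qpoch m = prod ?g {1..m}"
    unfolding qpoch_def by (rule prod.reindex_bij_witness[of _ "\<lambda>j. j - 1" Suc]) auto
  also have "{1..m} = ?B \<union> ?C"
    by auto
  also have "prod ?g (?B \<union> ?C) = prod ?g ?B * prod ?g ?C"
    by (rule prod.union_disjoint) auto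
  also have "prod ?g ?C = (\<Prod>i<m div 3. ?g (3 * Suc i))"
    by (rule prod.reindex_bij_witness[of _ "\<lambda>i. 3 * Suc i" "\<lambda>j. j div 3 - 1"]) auto
  also have "\<dots> = dil 3 (qpoch (m div 3))"
    unfolding qpoch_def dil_def
    by (subst fps_compose_prod_distrib)
      (auto simp: fps_compose_sub_distrib simp flip: fps_compose_power power_Suc power_mult intro!: prod.cong)
  finally show ?thesis .
qed

text \<open>Up to $q^m$ only parts at most $m$ matter. There the generating function $F$ satisfies
  $F b^3 = 1$, while $(q)_m = b c$ with $c$ from the multiples of 3, so $F (q)_m^3 = c^3$.\<close>

lemma p33_gf_mult: "p33_gf * euler ^ 3 = dil 3 euler ^ 3"
proof (rule fps_ext)
  fix m :: nat
  let ?B = "{j. j \<in> {1..m} \<and> \<not> 3 dvd j}"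
  let ?S = "?B \<times> {..<3::nat}"
  define F where "F = Abs_fps (\<lambda>n. int (card (parts_in ?S n)))"
  define b where "b = (\<Prod>j\<in>?B. 1 - fps_X ^ j :: int fps)"
  define c where "c = dil 3 (qpoch (m div 3))"
  have "F * (\<Prod>x\<in>?S. 1 - fps_X ^ fst x) = 1"
    unfolding F_def by (rule parts_gf_int_mult) auto
  also have "(\<Prod>x\<in>?S. 1 - fps_X ^ fst x) = (\<Prod>j\<in>?B. \<Prod>c<3::nat. 1 - fps_X ^ j :: int fps)"
    unfolding prod.cartesian_product case_prod_unfold ..
  also have "\<dots> = b ^ 3"
    by (simp only: b_def prod_constant card_lessThan prod_power_distrib)
  finally have Fb: "F * b ^ 3 = 1" .
  have q: "qpoch m = b * c"
    unfolding b_def c_def by (rule qpoch_split)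
  have "fps_X ^ Suc m dvd p33_gf - F"
    unfolding fps_X_power_dvd_iff p33_gf_def F_def p33_def
    using regular_partitions_eq_parts_in[of _ m 3 3] by simp
  moreover have "fps_X ^ Suc m dvd dil 3 euler - c"
  proof -
    \<comment> \<open>Stopping at \<open>m div 3\<close> suffices because $3 (m div 3 + 1) >
      m$.\<close>
    have "fps_X ^ (3 * Suc (m div 3)) dvd dil 3 euler - c"
      unfolding c_def dil_diff[symmetric] by (intro dil_dvd euler_qpoch) simp
    then show ?thesis
      by (rule dvd_trans[OF le_imp_power_dvd, rotated]) presburger
  qed
  moreover have "p33_gf * euler ^ 3 - dil 3 euler ^ 3 =
      (p33_gf - F) * euler ^ 3 + F * ((euler - b * c) * (euler\<^sup>2 + euler * (b * c) + (b * c)\<^sup>2)) +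
      ((F * b ^ 3) * c ^ 3 - c ^ 3) - (dil 3 euler - c) * ((dil 3 euler)\<^sup>2 + dil 3 euler * c + c\<^sup>2)"
    by algebra
  ultimately have "fps_X ^ Suc m dvd p33_gf * euler ^ 3 - dil 3 euler ^ 3"
    using euler_qpoch[of m] unfolding Fb q by (auto intro!: dvd_add dvd_diff intro: dvd_mult dvd_mult2)
  then show "fps_nth (p33_gf * euler ^ 3) m = fps_nth (dil 3 euler ^ 3) m"
    unfolding fps_X_power_dvd_iff by simp
qed

section \<open>Supports modulo 5 and modulo 3\<close>

abbreviation chi12 :: "int \<Rightarrow> int" where
  "chi12 w \<equiv> chi4 w * chi3 w"

text \<open>Since this weight is even, \<open>theta 1 psi\<close> is $2 P$ and
  \<open>theta 3 psi\<close> is $2 Q$ in the notation of the introduction.\<close>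

definition psi :: "int \<Rightarrow> int" where
  "psi v = (if 3 dvd v then 0 else chi4 v * v)"

lemma square_mod_5: "(w :: int)\<^sup>2 mod 5 = (if 5 dvd w then 0 else if w mod 5 = 1 \<or> w mod 5 = 4 then 1 else 4)"
proof -
  have "w mod 5 = 0 \<or> w mod 5 = 1 \<or> w mod 5 = 2 \<or> w mod 5 = 3 \<or> w mod 5 = 4"
    by presburger
  then show ?thesis
    unfolding power_mod[of w, symmetric] dvd_eq_mod_eq_0 by (elim disjE; simp only:; simp)
qed

lemma square_mod_3: "(w :: int)\<^sup>2 mod 3 = (if 3 dvd w then 0 else 1)"
proof -
  have "w mod 3 = 0 \<or> w mod 3 = 1 \<or> w mod 3 = 2"
    by presburger
  then show ?thesis
    unfolding power_mod[of w, symmetric] dvd_eq_mod_eq_0 by (elim disjE; simp only:; simp)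
qed

lemma odd_square: "odd v \<Longrightarrow> 8 dvd (v :: int)\<^sup>2 - 1"
proof -
  assume "odd v"
  then have "v mod 8 = 1 \<or> v mod 8 = 3 \<or> v mod 8 = 5 \<or> v mod 8 = 7"
    by presburger
  then have "v\<^sup>2 mod 8 = 1 mod 8"
    unfolding power_mod[of v, symmetric] by (elim disjE; simp only:; simp)
  then show ?thesis
    by (simp only: mod_eq_dvd_iff)
qed

lemma coprime_6_square:
  assumes "odd v" "\<not> 3 dvd v"
  shows "24 dvd (v :: int)\<^sup>2 - 1"
proof -
  have "v\<^sup>2 mod 3 = 1 mod 3"
    using assms by (simp add: square_mod_3)
  then have "3 dvd v\<^sup>2 - 1"
    by (simp only: mod_eq_dvd_iff)
  moreover have "8 dvd v\<^sup>2 - 1"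
    using assms by (intro odd_square)
  moreover have "3 dvd x \<Longrightarrow> 8 dvd x \<Longrightarrow> 24 dvd x" for x :: int
    by presburger
  ultimately show ?thesis
    by blast
qed

lemma chi12_nz: "chi12 v \<noteq> 0 \<Longrightarrow> v \<noteq> 0 \<and> 24 dvd v\<^sup>2 - 1"
  using coprime_6_square[of v] chi4_nz[of v] chi3_nz[of v] by auto

lemma psi_nz: "psi v \<noteq> 0 \<Longrightarrow> v \<noteq> 0 \<and> 24 dvd v\<^sup>2 - 1"
  using coprime_6_square[of v] chi4_nz[of v] by (auto simp: psi_def split: if_splits)

lemma chi4_square: "chi4 v \<noteq> 0 \<Longrightarrow> v \<noteq> 0 \<and> 24 dvd 3 * (v\<^sup>2 - 1)"
  using mult_dvd_mono[OF dvd_refl[of 3] odd_square[OF chi4_nz[of v]]] chi4_nz[of v] by auto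

text \<open>Here $w^2$ is $1 - n$ modulo 5, and the squares 0, 1, 4 correspond to $n = 1, 0,
  2$.\<close>

lemma theta_set_1_mod_5:
  assumes "w \<in> theta_set 1 n"
  shows "n mod 5 \<in> {0, 2} \<or> n mod 5 = 1 \<and> 5 dvd w"
proof -
  define q r where "q = n div 5" and "r = n mod 5"
  have "n = 5 * q + r"
    by (simp add: q_def r_def)
  then have "int n = 5 * int q + int r"
    by simp
  then have "w\<^sup>2 = (1 - int r) + 5 * (5 * int n - int q)"
    using assms by (simp add: theta_set_def)
  then have "w\<^sup>2 mod 5 = (1 - int r) mod 5"
    by (simp only: mod_mult_self2)
  moreover have "r = 0 \<or> r = 1 \<or> r = 2 \<or> r = 3 \<or> r = 4"
    unfolding r_def by linarith
  ultimately show ?thesis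
    using square_mod_5[of w] unfolding r_def[symmetric] by (elim disjE) (simp_all split: if_splits)
qed

text \<open>Here $w^2$ is $n + 1$ modulo 5, and the squares 0, 1, 4 correspond to $n = 4, 0,
  3$.\<close>

lemma theta_set_9_mod_5:
  assumes "w \<in> theta_set 9 n"
  shows "n mod 5 \<in> {0, 3} \<or> 5 dvd w"
proof -
  define q r where "q = n div 5" and "r = n mod 5"
  have "n = 5 * q + r"
    by (simp add: q_def r_def)
  then have "int n = 5 * int q + int r"
    by simp
  then have "w\<^sup>2 = (int r + 1) + 5 * (3 * int n + 1 - w\<^sup>2 + int q)"
    using assms by (simp add: theta_set_def)
  then have "w\<^sup>2 mod 5 = ((int r + 1) + 5 * (3 * int n + 1 - w\<^sup>2 + int q)) mod 5"
    by (rule arg_cong)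
  also have "\<dots> = (int r + 1) mod 5"
    by (rule mod_mult_self2)
  finally have "w\<^sup>2 mod 5 = (int r + 1) mod 5" .
  moreover have "r = 0 \<or> r = 1 \<or> r = 2 \<or> r = 3 \<or> r = 4"
    unfolding r_def by linarith
  ultimately show ?thesis
    using square_mod_5[of w] unfolding r_def[symmetric] by (elim disjE) (simp_all split: if_splits)
qed

text \<open>At an exponent not divisible by \<open>d\<close>, \<open>theta_set\<close> may still
  contain some \<open>w\<close>, but integrality of $k (w^2 - 1)/24$ on the support of
  \<open>a\<close> forces \<open>a w = 0\<close> there.\<close>

lemma dil_theta:
  assumes "0 < d" and a: "\<And>v. a v \<noteq> 0 \<Longrightarrow> 24 dvd k * (v\<^sup>2 - 1)"
  shows "dil d (theta k a) = theta (int d * k) a"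
proof (rule fps_ext)
  fix n
  show "fps_nth (dil d (theta k a)) n = fps_nth (theta (int d * k) a) n"
  proof (cases "d dvd n")
    case True
    then obtain m where n: "n = d * m"
      by (rule dvdE)
    have "theta_set (int d * k) n = theta_set k m"
    proof -
      have "int d * k * w\<^sup>2 = 24 * int n + int d * k \<longleftrightarrow> int d * (k * w\<^sup>2) = int d * (24 * int m + k)" for w
        by (simp add: n algebra_simps)
      then show ?thesis
        using assms(1) by (simp add: theta_set_def)
    qed
    then show ?thesis
      using assms(1) by (simp add: dil_nth n theta_def)
  next
    case False
    have "a w = 0" if "w \<in> theta_set (int d * k) n" for w
    proof (rule ccontr)
      assume "a w \<noteq> 0"
      then have "24 dvd k * (w\<^sup>2 - 1)"
        by (rule a)
      then obtain i where "k * (w\<^sup>2 - 1) = 24 * i"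
        by (rule dvdE)
      moreover have "int d * (k * (w\<^sup>2 - 1)) = 24 * int n"
        using that by (simp add: theta_set_def algebra_simps)
      ultimately have "int n = int d * i"
        by simp
      then show False
        using False by (metis dvd_triv_left int_dvd_int_iff)
    qed
    then show ?thesis
      using assms(1) False by (simp add: dil_nth theta_def)
  qed
qed

lemma dil_numeral_mult: "0 < k \<Longrightarrow> dil k (numeral m * A) = numeral m * dil k A"
  by (rule fps_ext) (simp add: dil_nth fps_numeral_mult_nth)

lemma two_dil_euler: "2 * dil 3 euler = theta 3 chi12"
proof -
  have "dil 3 (theta 1 chi12) = theta (int 3 * 1) chi12"
  proof (rule dil_theta)
    show "24 dvd 1 * (v\<^sup>2 - 1)" if "chi12 v \<noteq> 0" for v
      using chi12_nz[OF that] by simp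
  qed simp
  then show ?thesis
    unfolding two_euler[symmetric] by (simp add: dil_numeral_mult)
qed

lemma two_dil_euler_cube: "2 * dil 3 euler ^ 3 = theta 9 (\<lambda>y. chi4 y * y)"
proof -
  have "dil 3 (theta 3 (\<lambda>y. chi4 y * y)) = theta (int 3 * 3) (\<lambda>y. chi4 y * y)"
  proof (rule dil_theta)
    show "24 dvd 3 * (v\<^sup>2 - 1)" if "chi4 v * v \<noteq> 0" for v
      using that chi4_square[of v] by fastforce
  qed simp
  then show ?thesis
    unfolding two_euler_cube[symmetric] by (simp add: dil_numeral_mult dil_power)
qed

text \<open>Exponents 3 and 4 modulo 5 do not occur in $f$. At exponent 1 one has $w = 5 u$ and $n =
  25 m + 1$ with $24 m + 1 = u^2$; since 5 is 1 modulo 4 and $-1$ modulo 3,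
  \<open>chi12 (5 * u) = - chi12 u\<close>, so these terms are $- q f_{25}$.\<close>

lemma euler_supp: "supp_mod 5 5 {0, 2} (euler + fps_X * dil 25 euler)"
  unfolding supp_mod_def
proof (intro allI impI)
  fix n :: nat assume n: "n mod 5 \<notin> {0, 2}"
  have e: "2 * fps_nth euler m = (\<Sum>w\<in>theta_set 1 m. chi12 w)" for m
    using arg_cong[OF two_euler, of "\<lambda>A. fps_nth A m"] by (simp add: fps_numeral_mult_nth theta_def)
  have n0: "n \<noteq> 0"
    using n by (intro notI) simp
  have nth: "fps_nth (euler + fps_X * dil 25 euler) n =
      fps_nth euler n + (if 25 dvd n - 1 then fps_nth euler ((n - 1) div 25) else 0)"
    using n0 by (simp add: dil_nth)
  have five: "5 dvd w \<and> n mod 5 = 1" if "w \<in> theta_set 1 n" for w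
    using theta_set_1_mod_5[OF that] n by auto
  show "5 dvd fps_nth (euler + fps_X * dil 25 euler) n"
  proof (cases "25 dvd n - 1")
    case True
    then obtain m where "n - 1 = 25 * m"
      by (rule dvdE)
    then have m: "n = 25 * m + 1"
      using n0 by simp
    have "theta_set 1 n = (*) 5 ` theta_set 1 m"
    proof (intro equalityI subsetI)
      fix w assume w: "w \<in> theta_set 1 n"
      obtain u where "w = 5 * u"
        using five[OF w] by (auto elim: dvdE)
      then show "w \<in> (*) 5 ` theta_set 1 m"
        using w by (auto simp: theta_set_def m power_mult_distrib)
    qed (auto simp: theta_set_def m power_mult_distrib)
    then have "(\<Sum>w\<in>theta_set 1 n. chi12 w) = (\<Sum>u\<in>theta_set 1 m. chi12 (5 * u))"
      by (simp add: sum.reindex inj_on_def)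
    also have "\<dots> = (\<Sum>u\<in>theta_set 1 m. - chi12 u)"
    proof (rule sum.cong)
      fix u :: int
      have "chi4 (5 * u) = chi4 u"
        by (rule chi4_cong) simp
      moreover have "chi3 (5 * u) = chi3 (- u)"
        by (rule chi3_cong) simp
      ultimately show "chi12 (5 * u) = - chi12 u"
        by (simp add: chi3_minus)
    qed simp
    finally have "2 * fps_nth euler n = - (2 * fps_nth euler m)"
      unfolding e by (simp add: sum_negf)
    then show ?thesis
      unfolding nth by (simp add: m)
  next
    case False
    have "theta_set 1 n = {}"
    proof (rule ccontr)
      assume "theta_set 1 n \<noteq> {}"
      then obtain w where w: "w \<in> theta_set 1 n"
        by blast
      obtain u where "w = 5 * u"
        using five[OF w] by (auto elim: dvdE)
      then have "25 * u\<^sup>2 = 24 * int n + 1"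
        using w by (simp add: theta_set_def power_mult_distrib)
      then have "int n - 1 = 25 * (int n - u\<^sup>2)"
        by simp
      then have "25 dvd int n - 1"
        by (rule dvdI)
      then show False
        using False n0 by presburger
    qed
    then have "2 * fps_nth euler n = 0"
      by (simp add: e)
    then show ?thesis
      unfolding nth using False by simp
  qed
qed

text \<open>Outside the classes 0 and 3 every \<open>w\<close> is a multiple of 5, and so is its
  weight.\<close>

lemma dil_euler_cube_supp: "supp_mod 5 5 {0, 3} (dil 3 euler ^ 3)"
  unfolding supp_mod_def
proof (intro allI impI)
  fix n :: nat assume n: "n mod 5 \<notin> {0, 3}"
  have "5 dvd chi4 w * w" if "w \<in> theta_set 9 n" for w
    using theta_set_9_mod_5[OF that] n by auto
  then have "5 dvd fps_nth (2 * dil 3 euler ^ 3) n"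
    unfolding two_dil_euler_cube by (auto simp: theta_def intro!: dvd_sum)
  then show "5 dvd fps_nth (dil 3 euler ^ 3) n"
    unfolding fps_numeral_mult_nth by presburger
qed

lemma theta_psi_supp: "supp_mod 5 5 {0, 2} (theta 1 psi)"
  unfolding supp_mod_def
proof (intro allI impI)
  fix n :: nat assume n: "n mod 5 \<notin> {0, 2}"
  have "5 dvd psi w" if "w \<in> theta_set 1 n" for w
    using theta_set_1_mod_5[OF that] n by (auto simp: psi_def)
  then show "5 dvd fps_nth (theta 1 psi) n"
    by (auto simp: theta_def intro!: dvd_sum)
qed

text \<open>From $w^2 = 8 n + 1$ it follows that $w^2$ is $1 - n$ modulo 3: $w$ prime to 3 means $n
  = 0$, and $w$ divisible by 3 means $n = 1$.\<close>

lemma theta_3_psi_supp: "supp_mod 0 3 {0} (theta 3 psi)"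
  unfolding supp_mod_def
proof (intro allI impI)
  fix n :: nat assume n: "n mod 3 \<notin> {0}"
  have "psi w = 0" if "w \<in> theta_set 3 n" for w
  proof -
    have "w\<^sup>2 = 8 * int n + 1"
      using that by (simp add: theta_set_def)
    moreover have "int n mod 3 \<noteq> 0"
      using n by simp presburger
    ultimately have "w\<^sup>2 mod 3 \<noteq> 1"
      by presburger
    then show ?thesis
      by (simp add: square_mod_3 psi_def split: if_splits)
  qed
  then show "0 dvd fps_nth (theta 3 psi) n"
    by (simp add: theta_def)
qed

lemma theta_3_rest_supp: "supp_mod 0 3 {1} (theta 3 (\<lambda>y. if 3 dvd y then chi4 y * y else 0))"
  unfolding supp_mod_def
proof (intro allI impI)
  fix n :: nat assume n: "n mod 3 \<notin> {1}"
  have "\<not> 3 dvd w" if "w \<in> theta_set 3 n" for w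
  proof -
    have "w\<^sup>2 = 8 * int n + 1"
      using that by (simp add: theta_set_def)
    moreover have "int n mod 3 \<noteq> 1"
      using n by simp presburger
    ultimately have "w\<^sup>2 mod 3 \<noteq> 0"
      by presburger
    then show ?thesis
      by (simp add: square_mod_3 split: if_splits)
  qed
  then show "0 dvd fps_nth (theta 3 (\<lambda>y. if 3 dvd y then chi4 y * y else 0)) n"
    by (simp add: theta_def)
qed

section \<open>Identities from binary quadratic forms\<close>

text \<open>The reflection exchanges the halves \<open>p dvd x - y\<close> and
  \<open>p dvd x + y\<close>, whose overlap is counted twice. A single half is a sublattice with
  linear coordinates, which the changes of variables below exploit.\<close>

lemma sum_reflection_split:
  fixes S :: "(int \<times> int) set" and f :: "int \<times> int \<Rightarrow> int"
  assumes "finite S"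
    and sym: "\<And>x y. (x, y) \<in> S \<Longrightarrow> (x, - y) \<in> S"
    and f: "\<And>x y. f (x, - y) = f (x, y)"
    and dvd: "\<And>x y. (x, y) \<in> S \<Longrightarrow> f (x, y) \<noteq> 0 \<Longrightarrow> p dvd x - y \<or> p dvd x + y"
  shows "sum f S = 2 * sum f {(x, y) \<in> S. p dvd x - y} - sum f {(x, y) \<in> S. p dvd x - y \<and> p dvd x + y}"
proof -
  let ?A = "{(x, y) \<in> S. p dvd x - y}" and ?B = "{(x, y) \<in> S. p dvd x + y}"
  have fin: "finite ?A" "finite ?B"
    by (rule finite_subset[OF _ assms(1)]; auto)+
  have "sum f S = sum f (?A \<union> ?B)"
    by (rule sum.mono_neutral_right[OF assms(1)]) (use dvd in auto)
  moreover have "sum f (?A \<union> ?B) + sum f (?A \<inter> ?B) = sum f ?A + sum f ?B"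
    using fin by (rule sum.union_inter)
  moreover have "?A \<inter> ?B = {(x, y) \<in> S. p dvd x - y \<and> p dvd x + y}"
    by auto
  moreover have "sum f ?B = sum f ?A"
    by (rule sum.reindex_bij_witness[of _ "\<lambda>(x, y). (x, - y)" "\<lambda>(x, y). (x, - y)"]) (auto simp: f sym)
  ultimately show ?thesis
    by simp
qed

text \<open>
  Both sums become sums over $2 z^2 + 2 z t + 5 t^2 = 24 m + 2$, via $w = z + 5 t$ on the left and
  $u = z + 2 t$, $v = z - t$ on the right; exchanging $u$ and $v$ is the symmetry
  $(z, t) \mapsto (z + t, - t)$.
\<close>

lemma sum_quadratic_5:
  "3 * (\<Sum>(w, z) | w\<^sup>2 + 9 * z\<^sup>2 = 120 * int m + 10 \<and> 5 dvd w - z. chi12 w * (chi4 z * z)) =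
   3 * (\<Sum>(u, v) | u\<^sup>2 + v\<^sup>2 = 24 * int m + 2 \<and> 3 dvd u - v. chi12 u * psi v)"
proof -
  let ?K = "{(z, t). 2 * z\<^sup>2 + 2 * z * t + 5 * t\<^sup>2 = 24 * int m + 2}"
  \<comment> \<open>The product of the characters, common to both sums in the coordinates
    \<open>(z, t)\<close>.\<close>
  define g where "g z t = chi4 (z - t) * chi4 z * chi3 (z - t)" for z t
  have par: "odd z \<and> even t" if "(z, t) \<in> ?K" for z t
  proof -
    have K: "2 * z\<^sup>2 + 2 * z * t + 5 * t\<^sup>2 = 24 * int m + 2"
      using that by simp
    then have "even (2 * z\<^sup>2 + 2 * z * t + 5 * t\<^sup>2)"
      by simp
    then have "even t"
      by simp
    then obtain s where s: "t = 2 * s"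
      by (rule evenE)
    have "z\<^sup>2 = 2 * (6 * int m - z * s - 5 * s\<^sup>2) + 1"
      using K unfolding s by (simp add: power2_eq_square algebra_simps)
    then have "odd (z\<^sup>2)"
      by simp
    then show ?thesis
      using \<open>even t\<close> by simp
  qed
  \<comment> \<open>With $t$ even, shifts by $6 t$ and $2 t$ do not affect
    \<open>chi4\<close>.\<close>
  have dvd4: "4 dvd 6 * t" "4 dvd 2 * t" if "even t" for t :: int
    using that by presburger+
  have 1: "(\<Sum>(w, z) | w\<^sup>2 + 9 * z\<^sup>2 = 120 * int m + 10 \<and> 5 dvd w - z. chi12 w * (chi4 z * z)) =
      (\<Sum>(z, t)\<in>?K. g z t * z)"
  proof (rule sum.reindex_bij_witness[of _ "\<lambda>(z, t). (z + 5 * t, z)" "\<lambda>(w, z). (z, (w - z) div 5)"])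
    fix p assume "p \<in> ?K"
    then obtain z t where p: "p = (z, t)" and K: "2 * z\<^sup>2 + 2 * z * t + 5 * t\<^sup>2 = 24 * int m + 2"
      by auto
    have "(z + 5 * t)\<^sup>2 + 9 * z\<^sup>2 = 5 * (2 * z\<^sup>2 + 2 * z * t + 5 * t\<^sup>2)"
      by (simp add: power2_eq_square algebra_simps)
    then show "(case p of (z, t) \<Rightarrow> (z + 5 * t, z)) \<in> {(w, z). w\<^sup>2 + 9 * z\<^sup>2 = 120 * int m + 10 \<and> 5 dvd w - z}"
      unfolding K by (simp add: p)
  next
    fix p assume "p \<in> {(w, z). w\<^sup>2 + 9 * z\<^sup>2 = 120 * int m + 10 \<and> 5 dvd w - z}"
    then obtain w z where p: "p = (w, z)" and eq: "w\<^sup>2 + 9 * z\<^sup>2 = 120 * int m + 10" and d: "5 dvd w - z"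
      by auto
    obtain t where "w - z = 5 * t"
      using d by (rule dvdE)
    then have w: "w = z + 5 * t"
      by simp
    have "5 * (2 * z\<^sup>2 + 2 * z * t + 5 * t\<^sup>2) = 5 * (24 * int m + 2)"
      using eq unfolding w by (simp add: power2_eq_square algebra_simps)
    then have K: "(z, t) \<in> ?K"
      by simp
    then show "(case p of (w, z) \<Rightarrow> (z, (w - z) div 5)) \<in> ?K"
      by (simp add: p w)
    have "chi4 (z + 5 * t) = chi4 (z - t)" "chi3 (z + 5 * t) = chi3 (z - t)"
      using par[OF K] dvd4(1)[of t] by (auto intro!: chi4_cong chi3_cong)
    then show "(case case p of (w, z) \<Rightarrow> (z, (w - z) div 5) of (z, t) \<Rightarrow> g z t * z) =
        (case p of (w, z) \<Rightarrow> chi12 w * (chi4 z * z))"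
      by (simp add: p w g_def)
  qed auto
  have 2: "(\<Sum>(u, v) | u\<^sup>2 + v\<^sup>2 = 24 * int m + 2 \<and> 3 dvd u - v. chi12 u * psi v) =
      (\<Sum>(z, t)\<in>?K. g z t * (z - t))"
  proof (rule sum.reindex_bij_witness[of _ "\<lambda>(z, t). (z + 2 * t, z - t)" "\<lambda>(u, v). (v + (u - v) div 3, (u - v) div 3)"])
    fix p assume "p \<in> ?K"
    then obtain z t where p: "p = (z, t)" and K: "2 * z\<^sup>2 + 2 * z * t + 5 * t\<^sup>2 = 24 * int m + 2"
      by auto
    have "(z + 2 * t)\<^sup>2 + (z - t)\<^sup>2 = 2 * z\<^sup>2 + 2 * z * t + 5 * t\<^sup>2"
      by (simp add: power2_eq_square algebra_simps)
    then show "(case p of (z, t) \<Rightarrow> (z + 2 * t, z - t)) \<in> {(u, v). u\<^sup>2 + v\<^sup>2 = 24 * int m + 2 \<and> 3 dvd u - v}"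
      unfolding K by (simp add: p)
  next
    fix p assume "p \<in> {(u, v). u\<^sup>2 + v\<^sup>2 = 24 * int m + 2 \<and> 3 dvd u - v}"
    then obtain u v where p: "p = (u, v)" and eq: "u\<^sup>2 + v\<^sup>2 = 24 * int m + 2" and d: "3 dvd u - v"
      by auto
    obtain t where "u - v = 3 * t"
      using d by (rule dvdE)
    then have u: "u = v + 3 * t"
      by simp
    have K: "(v + t, t) \<in> ?K"
      using eq unfolding u by (simp add: power2_eq_square algebra_simps)
    then show "(case p of (u, v) \<Rightarrow> (v + (u - v) div 3, (u - v) div 3)) \<in> ?K"
      by (simp add: p u)
    have "chi4 (v + 3 * t) = chi4 (v + t)" "chi3 (v + 3 * t) = chi3 v"
      using par[OF K] dvd4(2)[of t] by (auto intro!: chi4_cong chi3_cong)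
    \<comment> \<open>As \<open>chi3 u = chi3 v\<close> vanishes when 3 divides \<open>v\<close>,
      the case distinction in \<open>psi\<close> disappears.\<close>
    moreover have "chi3 v * psi v = chi3 v * (chi4 v * v)"
      using chi3_nz[of v] by (auto simp: psi_def)
    ultimately show "(case case p of (u, v) \<Rightarrow> (v + (u - v) div 3, (u - v) div 3) of (z, t) \<Rightarrow> g z t * (z - t)) =
        (case p of (u, v) \<Rightarrow> chi12 u * psi v)"
      by (auto simp: p u g_def ac_simps)
  qed auto
  have 3: "(\<Sum>(z, t)\<in>?K. g z t * (z - t)) = (\<Sum>(z, t)\<in>?K. g z t * (z + 2 * t))"
  proof (rule sum.reindex_bij_witness[of _ "\<lambda>(z, t). (z + t, - t)" "\<lambda>(z, t). (z + t, - t)"])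
    fix p assume "p \<in> ?K"
    then obtain z t where p: "p = (z, t)" and K: "(z, t) \<in> ?K"
      by auto
    then show K': "(case p of (z, t) \<Rightarrow> (z + t, - t)) \<in> ?K"
      by (simp add: power2_eq_square algebra_simps)
    have "chi4 (z + t + t) = chi4 z" "chi4 (z + t) = chi4 (z - t)" "chi3 (z + t + t) = chi3 (z - t)"
      using par[OF K] dvd4(2)[of t] by (auto intro!: chi4_cong chi3_cong)
    then show "(case case p of (z, t) \<Rightarrow> (z + t, - t) of (z, t) \<Rightarrow> g z t * (z + 2 * t)) =
        (case p of (z, t) \<Rightarrow> g z t * (z - t))"
      by (simp add: p g_def)
  qed (auto simp: power2_eq_square algebra_simps)
  \<comment> \<open>Since $3 z = (z + 2 t) + 2 (z - t)$ and the symmetry makes the two sums on the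
    right equal, the total is three times either one.\<close>
  have "3 * (\<Sum>(z, t)\<in>?K. g z t * z) = (\<Sum>(z, t)\<in>?K. g z t * (z + 2 * t)) + 2 * (\<Sum>(z, t)\<in>?K. g z t * (z - t))"
    unfolding sum_distrib_left sum.distrib[symmetric] by (rule sum.cong) (auto simp: algebra_simps)
  then show ?thesis
    unfolding 1 2 using 3 by simp
qed

text \<open>This is $U(f f_3^3) = f P$ modulo 5, times 4. Modulo 5, $w^2 + 9 z^2$ is $(w - z)(w +
  z)$, so the left sum splits with $p = 5$ and its overlap has 5 dividing $z$. The right sum splits
  with $p = 3$; on its overlap 3 divides $v$ and \<open>psi\<close> vanishes.\<close>

lemma sec_euler_dil_euler_cube:
  "cong5 (4 * sec 5 0 (euler * dil 3 euler ^ 3)) (2 * (euler * theta 1 psi))"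
proof -
  have "5 dvd 4 * fps_nth (euler * dil 3 euler ^ 3) (5 * m) - 2 * fps_nth (euler * theta 1 psi) m" for m
  proof -
    let ?S = "{(w, z). w\<^sup>2 + 9 * z\<^sup>2 = 120 * int m + 10}" and ?f = "\<lambda>(w, z). chi12 w * (chi4 z * z)"
    let ?T = "{(u, v). u\<^sup>2 + v\<^sup>2 = 24 * int m + 2}" and ?g = "\<lambda>(u, v). chi12 u * psi v"
    have finS: "finite ?S"
      using finite_quadratic_set[of 1 9] by simp
    have finT: "finite ?T"
      using finite_quadratic_set[of 1 1] by simp
    have "4 * (euler * dil 3 euler ^ 3) = (2 * euler) * (2 * dil 3 euler ^ 3)"
      by simp
    then have "4 * fps_nth (euler * dil 3 euler ^ 3) (5 * m) = fps_nth ((2 * euler) * (2 * dil 3 euler ^ 3)) (5 * m)"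
      by (simp only: fps_numeral_mult_nth[symmetric])
    also have "\<dots> = (\<Sum>(w, z) | 1 * w\<^sup>2 + 9 * z\<^sup>2 = 24 * int (5 * m) + 1 + 9. chi12 w * (chi4 z * z))"
      unfolding two_euler two_dil_euler_cube
    proof (rule theta_mult_nth)
      show "v \<noteq> 0 \<and> 24 dvd 1 * (v\<^sup>2 - 1)" if "chi12 v \<noteq> 0" for v
        using chi12_nz[OF that] by simp
      show "v \<noteq> 0 \<and> 24 dvd 9 * (v\<^sup>2 - 1)" if "chi4 v * v \<noteq> 0" for v
      proof -
        have "24 dvd 3 * (v\<^sup>2 - 1)"
          using that chi4_square[of v] by fastforce
        then have "24 dvd 3 * (3 * (v\<^sup>2 - 1))"
          by (rule dvd_mult)
        then show ?thesis
          using that by auto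
      qed
    qed simp_all
    also have "\<dots> = sum ?f ?S"
      by (rule arg_cong[where f = "sum ?f"]) auto
    also have "\<dots> = 2 * sum ?f {(w, z) \<in> ?S. 5 dvd w - z} - sum ?f {(w, z) \<in> ?S. 5 dvd w - z \<and> 5 dvd w + z}"
    proof (rule sum_reflection_split[OF finS])
      fix w z assume "(w, z) \<in> ?S"
      then have "(w - z) * (w + z) = 5 * (24 * int m + 2 - 2 * z\<^sup>2)"
        by (simp add: power2_eq_square algebra_simps)
      then have "5 dvd (w - z) * (w + z)"
        by simp
      then show "5 dvd w - z \<or> 5 dvd w + z"
        by (subst (asm) prime_dvd_mult_iff) auto
    qed (auto simp: chi4_minus)
    finally have L: "4 * fps_nth (euler * dil 3 euler ^ 3) (5 * m) =
      2 * sum ?f {(w, z) \<in> ?S. 5 dvd w - z} - sum ?f {(w, z) \<in> ?S. 5 dvd w - z \<and> 5 dvd w + z}" .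
    have L0: "5 dvd sum ?f {(w, z) \<in> ?S. 5 dvd w - z \<and> 5 dvd w + z}"
    proof (intro dvd_sum)
      fix p assume "p \<in> {(w, z) \<in> ?S. 5 dvd w - z \<and> 5 dvd w + z}"
      then obtain w z where p: "p = (w, z)" and "5 dvd w - z" "5 dvd w + z"
        by auto
      then have "5 dvd z"
        by presburger
      then show "5 dvd ?f p"
        by (simp add: p)
    qed
    have "2 * fps_nth (euler * theta 1 psi) m = fps_nth ((2 * euler) * theta 1 psi) m"
      by (simp only: fps_numeral_mult_nth mult.assoc)
    also have "\<dots> = (\<Sum>(u, v) | 1 * u\<^sup>2 + 1 * v\<^sup>2 = 24 * int m + 1 + 1. chi12 u * psi v)"
      unfolding two_euler
    proof (rule theta_mult_nth)
      show "v \<noteq> 0 \<and> 24 dvd 1 * (v\<^sup>2 - 1)" if "chi12 v \<noteq> 0" for v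
        using chi12_nz[OF that] by simp
      show "v \<noteq> 0 \<and> 24 dvd 1 * (v\<^sup>2 - 1)" if "psi v \<noteq> 0" for v
        using psi_nz[OF that] by simp
    qed simp_all
    also have "\<dots> = sum ?g ?T"
      by (rule arg_cong[where f = "sum ?g"]) auto
    also have "\<dots> = 2 * sum ?g {(u, v) \<in> ?T. 3 dvd u - v} - sum ?g {(u, v) \<in> ?T. 3 dvd u - v \<and> 3 dvd u + v}"
    proof (rule sum_reflection_split[OF finT])
      fix u v assume "?g (u, v) \<noteq> 0"
      then have "\<not> 3 dvd u" "\<not> 3 dvd v"
        using chi3_nz[of u] by (auto simp: psi_def)
      then show "3 dvd u - v \<or> 3 dvd u + v"
        by presburger
    qed (auto simp: psi_def chi4_minus)
    also have "sum ?g {(u, v) \<in> ?T. 3 dvd u - v \<and> 3 dvd u + v} = 0"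
    proof (intro sum.neutral ballI)
      fix p assume "p \<in> {(u, v) \<in> ?T. 3 dvd u - v \<and> 3 dvd u + v}"
      then obtain u v where p: "p = (u, v)" and "3 dvd u - v" "3 dvd u + v"
        by auto
      then have "3 dvd v"
        by presburger
      then show "?g p = 0"
        by (simp add: p psi_def)
    qed
    finally have R: "2 * fps_nth (euler * theta 1 psi) m = 2 * sum ?g {(u, v) \<in> ?T. 3 dvd u - v}"
      by simp
    have "sum ?f {(w, z) \<in> ?S. 5 dvd w - z} = sum ?g {(u, v) \<in> ?T. 3 dvd u - v}"
      using sum_quadratic_5[of m] by simp
    then show ?thesis
      unfolding L R using L0 by simp
  qed
  then show ?thesis
    by (simp add: cong5_def five_dvd_fps_iff fps_numeral_mult_nth)
qed

text \<open>The weight for which \<open>theta 3 kappa\<close> is $2 (Q - 2 W)$.\<close>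

definition kappa :: "int \<Rightarrow> int" where
  "kappa y = (if 3 dvd y then - 2 else 1) * (chi4 y * y)"

text \<open>
  With $w = v + 2 r$, the involution $(v, r) \mapsto (- 2 v - 3 r, v + 2 r)$ preserves
  $v^2 + 3 w^2$ and reverses the sign of the summand.
\<close>

lemma sum_quadratic_3:
  "(\<Sum>(v, w) | v\<^sup>2 + 3 * w\<^sup>2 = m. chi12 w * psi v - chi12 v * kappa w) = 0"
proof -
  let ?D = "{(v, w). v\<^sup>2 + 3 * w\<^sup>2 = m}"
  define d where "d v w = chi12 w * psi v - chi12 v * kappa w" for v w
  define f where "f = (\<lambda>(v, w). d v w)"
  let ?K = "{(v, r). v\<^sup>2 + 3 * (v + 2 * r)\<^sup>2 = m \<and> even (v + r)}"
  have d_minus: "d v (- w) = d v w" for v w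
    by (simp add: d_def kappa_def chi3_minus chi4_minus)
  have d_odd: "odd v \<and> odd w" if "d v w \<noteq> 0" for v w
    using that chi4_nz[of v] chi4_nz[of w] by (auto simp: d_def psi_def kappa_def split: if_splits)
  have d_even: "d v w = 0" if "even v" for v w
    using d_odd[of v w] that by blast
  have "finite ?D"
    using finite_quadratic_set[of 1 3] by simp
  \<comment> \<open>For odd $v$ and $w$, one of $v - w$ and $v + w$ is divisible by 4.\<close>
  then have "sum f ?D = 2 * sum f {(v, w) \<in> ?D. 4 dvd v - w} - sum f {(v, w) \<in> ?D. 4 dvd v - w \<and> 4 dvd v + w}"
  proof (rule sum_reflection_split)
    fix v w assume "f (v, w) \<noteq> 0"
    then have "odd v \<and> odd w"
      using d_odd by (simp add: f_def)
    then show "4 dvd v - w \<or> 4 dvd v + w"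
      by presburger
  qed (auto simp: f_def d_minus)
  also have "sum f {(v, w) \<in> ?D. 4 dvd v - w \<and> 4 dvd v + w} = 0"
  proof (intro sum.neutral ballI)
    fix p assume "p \<in> {(v, w) \<in> ?D. 4 dvd v - w \<and> 4 dvd v + w}"
    then obtain v w where p: "p = (v, w)" and "4 dvd v - w" "4 dvd v + w"
      by auto
    then have "even v"
      by presburger
    then show "f p = 0"
      using d_odd[of v w] by (auto simp: p f_def)
  qed
  also have "sum f {(v, w) \<in> ?D. 4 dvd v - w} = (\<Sum>(v, r)\<in>?K. d v (v + 2 * r))"
  proof (rule sum.reindex_bij_witness[of _ "\<lambda>(v, r). (v, - (v + 2 * r))" "\<lambda>(v, w). (v, - (v + w) div 2)"])
    fix p assume "p \<in> {(v, w) \<in> ?D. 4 dvd v - w}"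
    then obtain v w where p: "p = (v, w)" and D: "v\<^sup>2 + 3 * w\<^sup>2 = m" and "4 dvd v - w"
      by auto
    from \<open>4 dvd v - w\<close> obtain s where s: "v - w = 4 * s"
      by (rule dvdE)
    \<comment> \<open>This solves $w = - (v + 2 r)$. Then $v - w = 2 (v + r)$, so divisibility by 4
      becomes \<open>even (v + r)\<close>; the sign of $w$ is harmless by
      \<open>d_minus\<close>.\<close>
    define r where "r = 2 * s - v"
    have w: "w = - (v + 2 * r)"
      using s by (simp add: r_def)
    have r: "- (v + w) div 2 = r"
      by (simp add: w)
    show "(case case p of (v, w) \<Rightarrow> (v, - (v + w) div 2) of (v, r) \<Rightarrow> (v, - (v + 2 * r))) = p"
      using w r by (simp add: p)
    have "(v, r) \<in> ?K"
      using D unfolding w power2_minus by (simp add: r_def)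
    then show "(case p of (v, w) \<Rightarrow> (v, - (v + w) div 2)) \<in> ?K"
      using r by (simp add: p)
    have "d v w = d v (v + 2 * r)"
      unfolding w by (rule d_minus)
    then show "(case case p of (v, w) \<Rightarrow> (v, - (v + w) div 2) of (v, r) \<Rightarrow> d v (v + 2 * r)) = f p"
      using r by (simp add: p f_def)
  next
    fix p assume "p \<in> ?K"
    then obtain v r where p: "p = (v, r)" and K: "v\<^sup>2 + 3 * (v + 2 * r)\<^sup>2 = m" "even (v + r)"
      by auto
    show "(case case p of (v, r) \<Rightarrow> (v, - (v + 2 * r)) of (v, w) \<Rightarrow> (v, - (v + w) div 2)) = p"
      by (simp add: p)
    have "v\<^sup>2 + 3 * (- (v + 2 * r))\<^sup>2 = m"
      using K(1) by (simp only: power2_minus)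
    moreover have "4 dvd v - - (v + 2 * r)"
      using K(2) by presburger
    ultimately show "(case p of (v, r) \<Rightarrow> (v, - (v + 2 * r))) \<in> {(v, w) \<in> ?D. 4 dvd v - w}"
      by (simp add: p)
  qed
  finally have fD: "sum f ?D = 2 * (\<Sum>(v, r)\<in>?K. d v (v + 2 * r))"
    by simp
  have "(\<Sum>(v, r)\<in>?K. d v (v + 2 * r)) = (\<Sum>(v, r)\<in>?K. - d v (v + 2 * r))"
  proof (rule sum.reindex_bij_witness[of _ "\<lambda>(v, r). (- 2 * v - 3 * r, v + 2 * r)" "\<lambda>(v, r). (- 2 * v - 3 * r, v + 2 * r)"])
    fix p assume "p \<in> ?K"
    then obtain v r where p: "p = (v, r)" and K: "v\<^sup>2 + 3 * (v + 2 * r)\<^sup>2 = m" "even (v + r)"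
      by auto
    let ?v = "- 2 * v - 3 * r"
    have "?v\<^sup>2 + 3 * (?v + 2 * (v + 2 * r))\<^sup>2 = v\<^sup>2 + 3 * (v + 2 * r)\<^sup>2"
      by (simp add: power2_eq_square algebra_simps)
    moreover have "even (?v + (v + 2 * r))"
      using K(2) by presburger
    ultimately show "(case p of (v, r) \<Rightarrow> (- 2 * v - 3 * r, v + 2 * r)) \<in> ?K"
      using K(1) by (simp add: p)
    \<comment> \<open>For the image $(v', r')$ of $(v, r)$ one has $v' + 2 r' = r$.\<close>
    have "d ?v r = - d v (v + 2 * r)"
    proof (cases "even v")
      case True
      then have "even r"
        using K(2) by simp
      then show ?thesis
        using True by (simp add: d_even)
    next
      case False
      then have "odd r"
        using K(2) by simp
      \<comment> \<open>Both pairs have \<open>chi4\<close> product $-1$, so the sign change must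
        come from the part modulo 3, which the nine residue cases of $(v, r)$ settle.\<close>
      define h where "h v w = chi3 w * (if 3 dvd v then 0 else v) - chi3 v * ((if 3 dvd w then - 2 else 1) * w)" for v w
      have d_h: "d v w = (chi4 v * chi4 w) * h v w" for v w
        by (simp add: d_def h_def psi_def kappa_def algebra_simps)
      have "chi4 v * chi4 (v + 2 * r) = - 1"
        using False \<open>odd r\<close> by (rule chi4_mult_add)
      moreover have "chi4 ?v * chi4 r = - 1"
      proof -
        have "chi4 ?v = chi4 (r + 2 * (- v))"
          by (rule chi4_cong) simp
        then show ?thesis
          using chi4_mult_add[of r "- v"] False \<open>odd r\<close> by (simp add: mult.commute)
      qed
      moreover have "h ?v r = - h v (v + 2 * r)"
      proof -
        have "?v mod 3 = v mod 3"
          unfolding mod_eq_dvd_iff by presburger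
        moreover have "(v + 2 * r) mod 3 = (v mod 3 + 2 * (r mod 3)) mod 3"
          by (metis mod_add_left_eq mod_add_right_eq mod_mult_right_eq)
        ultimately have c: "(v + 2 * r) mod 3 = (v mod 3 + 2 * (r mod 3)) mod 3" "?v mod 3 = v mod 3"
          by simp_all
        have "v mod 3 = 0 \<or> v mod 3 = 1 \<or> v mod 3 = 2" "r mod 3 = 0 \<or> r mod 3 = 1 \<or> r mod 3 = 2"
          by presburger+
        then show ?thesis
          unfolding h_def chi3_def dvd_eq_mod_eq_0 c by (elim disjE; simp only:; simp)
      qed
      ultimately show ?thesis
        unfolding d_h by simp
    qed
    then show "(case case p of (v, r) \<Rightarrow> (- 2 * v - 3 * r, v + 2 * r) of (v, r) \<Rightarrow> - d v (v + 2 * r)) =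
        (case p of (v, r) \<Rightarrow> d v (v + 2 * r))"
      by (simp add: p)
  qed (auto simp: power2_eq_square algebra_simps)
  also have "\<dots> = - (\<Sum>(v, r)\<in>?K. d v (v + 2 * r))"
    by (simp add: case_prod_unfold sum_negf)
  finally show ?thesis
    using fD by (simp add: f_def d_def)
qed

lemma theta_kappa: "theta 3 kappa = theta 3 psi - 2 * theta 3 (\<lambda>y. if 3 dvd y then chi4 y * y else 0)"
proof -
  have "sum kappa S = sum psi S - 2 * (\<Sum>y\<in>S. if 3 dvd y then chi4 y * y else 0)" for S
    unfolding sum_distrib_left sum_subtractf[symmetric]
    by (rule sum.cong) (auto simp: kappa_def psi_def)
  then show ?thesis
    by (intro fps_ext) (simp add: theta_def fps_numeral_mult_nth)
qed

lemma theta_cube_split: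
  "2 * euler ^ 3 = theta 3 psi + theta 3 (\<lambda>y. if 3 dvd y then chi4 y * y else 0)"
proof -
  have "(\<Sum>y\<in>S. chi4 y * y) = sum psi S + (\<Sum>y\<in>S. if 3 dvd y then chi4 y * y else 0)" for S
    unfolding sum.distrib[symmetric] by (rule sum.cong) (auto simp: psi_def)
  then show ?thesis
    unfolding two_euler_cube by (intro fps_ext) (simp add: theta_def)
qed

text \<open>This is $f_3 P = f (Q - 2 W)$, times 4. Both coefficients are sums over the same form
  $v^2 + 3 w^2 = 24 n + 4$, with difference \<open>sum_quadratic_3\<close>.\<close>

lemma dil_euler_theta_psi: "2 * dil 3 euler * theta 1 psi = 2 * euler * theta 3 kappa"
proof (rule fps_ext)
  fix n
  let ?D = "{(v, w). v\<^sup>2 + 3 * w\<^sup>2 = 24 * int n + 4}"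
  have c: "v \<noteq> 0 \<and> 24 dvd k * (v\<^sup>2 - 1)" if "chi12 v \<noteq> 0" for v k
    using chi12_nz[OF that] by simp
  have "fps_nth (2 * dil 3 euler * theta 1 psi) n =
      (\<Sum>(w, v) | 3 * w\<^sup>2 + 1 * v\<^sup>2 = 24 * int n + 3 + 1. chi12 w * psi v)"
    unfolding two_dil_euler
  proof (rule theta_mult_nth)
    show "v \<noteq> 0 \<and> 24 dvd 1 * (v\<^sup>2 - 1)" if "psi v \<noteq> 0" for v
      using psi_nz[OF that] by simp
    show "v \<noteq> 0 \<and> 24 dvd 3 * (v\<^sup>2 - 1)" if "chi12 v \<noteq> 0" for v
      using that by (rule c)
  qed simp_all
  also have "\<dots> = (\<Sum>(v, w)\<in>?D. chi12 w * psi v)"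
    by (rule sum.reindex_bij_witness[of _ prod.swap prod.swap]) auto
  finally have 1: "fps_nth (2 * dil 3 euler * theta 1 psi) n = (\<Sum>(v, w)\<in>?D. chi12 w * psi v)" .
  have "fps_nth (2 * euler * theta 3 kappa) n =
      (\<Sum>(v, w) | 1 * v\<^sup>2 + 3 * w\<^sup>2 = 24 * int n + 1 + 3. chi12 v * kappa w)"
    unfolding two_euler
  proof (rule theta_mult_nth)
    show "w \<noteq> 0 \<and> 24 dvd 3 * (w\<^sup>2 - 1)" if "kappa w \<noteq> 0" for w
    proof -
      have "chi4 w \<noteq> 0"
        using that by (auto simp: kappa_def)
      then show ?thesis
        by (rule chi4_square)
    qed
    show "v \<noteq> 0 \<and> 24 dvd 1 * (v\<^sup>2 - 1)" if "chi12 v \<noteq> 0" for v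
      using that by (rule c)
  qed simp_all
  also have "\<dots> = (\<Sum>(v, w)\<in>?D. chi12 v * kappa w)"
    by (rule arg_cong[where f = "sum (\<lambda>(v, w). chi12 v * kappa w)"]) auto
  finally have 2: "fps_nth (2 * euler * theta 3 kappa) n = (\<Sum>(v, w)\<in>?D. chi12 v * kappa w)" .
  show "fps_nth (2 * dil 3 euler * theta 1 psi) n = fps_nth (2 * euler * theta 3 kappa) n"
    unfolding 1 2 using sum_quadratic_3[of "24 * int n + 4"]
    by (simp only: case_prod_unfold sum_subtractf right_minus_eq)
qed

lemma cong5_0_add: "cong5 A 0 \<Longrightarrow> cong5 (A + B) B"
  using cong5_add[of A 0 B B] by simp

section \<open>The congruences\<close>

text \<open>Write $f = A - C$ with $C = q f_{25}$ and $H = f_3^3$. In $f^2 H + 2 A C H = A^2 H + C^2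
  H$ the right side has no exponent 1 modulo 5, so class 1 of $f^2 H$ is $- 2 f_5 U(A H)$ modulo
  5.\<close>

lemma sec_p33_gf: "cong5 (2 * sec 5 1 p33_gf) (- (2 * theta 1 psi * dil 5 euler))"
proof -
  let ?D = "dil 25 euler" and ?H = "dil 3 euler ^ 3" and ?S = "sec 5 1 p33_gf"
  let ?X = "fps_X :: int fps"
  define A where "A = euler + ?X * ?D"
  define C where "C = ?X * ?D"
  have A: "supp_mod 5 5 {0, 2} A"
    unfolding A_def by (rule euler_supp)
  have H: "supp_mod 5 5 {0, 3} ?H"
    by (rule dil_euler_cube_supp)
  have C: "supp_mod 5 5 {1} C"
    unfolding C_def by (rule supp_mod_mult[OF supp_mod_fps_X supp_mod_dil]) auto
  have D: "?D = dil 5 (dil 5 euler)"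
    by (simp add: dil_dil)
  have AA: "supp_mod 5 5 {0, 2, 4} (A * A)"
    by (rule supp_mod_mult[OF A A]) auto
  have AAH: "supp_mod 5 5 {0, 2, 3, 4} (A * A * ?H)"
    by (rule supp_mod_mult[OF AA H]) auto
  have CC: "supp_mod 5 5 {2} (C * C)"
    by (rule supp_mod_mult[OF C C]) auto
  have CCH: "supp_mod 5 5 {0, 2} (C * C * ?H)"
    by (rule supp_mod_mult[OF CC H]) auto
  have CH: "supp_mod 5 5 {1, 4} (C * ?H)"
    by (rule supp_mod_mult[OF C H]) auto
  have sum: "supp_mod 5 5 {0, 2, 3, 4} (A * A * ?H + C * C * ?H)"
    by (rule supp_mod_add[OF AAH CCH]) auto
  have X: "sec 5 1 (?X * B) = sec 5 0 B" for B
    by (rule fps_ext) simp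
  have "sec 5 1 (euler\<^sup>2 * ?H) + sec 5 0 (2 * A * ?H) * dil 5 euler = sec 5 1 (A * A * ?H + C * C * ?H)"
  proof -
    have "euler\<^sup>2 * ?H + ?X * (2 * A * ?H * ?D) = A * A * ?H + C * C * ?H"
      unfolding A_def C_def by algebra
    then have "sec 5 1 (euler\<^sup>2 * ?H) + sec 5 1 (?X * (2 * A * ?H * ?D)) = sec 5 1 (A * A * ?H + C * C * ?H)"
      by (simp only: sec_add[symmetric])
    then show ?thesis
      unfolding X D by (simp only: sec_mult_dil zero_less_numeral)
  qed
  moreover have "cong5 (sec 5 1 (A * A * ?H + C * C * ?H)) 0"
    by (rule cong5_sec_0[OF sum]) auto
  ultimately have 1: "cong5 (sec 5 1 (euler\<^sup>2 * ?H) + sec 5 0 (2 * A * ?H) * dil 5 euler) 0"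
    by simp
  \<comment> \<open>Under $U$ the series $A$ may be replaced by $f$, because $C H$ lives on the
    classes 1 and 4.\<close>
  have "2 * A * ?H = 2 * (euler * ?H) + 2 * (C * ?H)"
    unfolding A_def C_def by algebra
  then have "sec 5 0 (2 * A * ?H) = sec 5 0 (2 * (C * ?H)) + sec 5 0 (2 * (euler * ?H))"
    by (simp only: sec_add[symmetric] add.commute)
  moreover have "cong5 (sec 5 0 (2 * (C * ?H))) 0"
    by (rule cong5_sec_0[OF supp_mod_cmult[OF CH]]) auto
  ultimately have 2: "cong5 (sec 5 0 (2 * A * ?H)) (sec 5 0 (2 * (euler * ?H)))"
    by (simp only: cong5_0_add)
  have "cong5 (p33_gf * euler ^ 5) (p33_gf * dil 5 euler)"
    by (intro cong5_mult cong5_refl euler_power_5)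
  moreover have "p33_gf * euler ^ 5 = euler\<^sup>2 * (p33_gf * euler ^ 3)"
    by algebra
  ultimately have "cong5 (euler\<^sup>2 * ?H) (p33_gf * dil 5 euler)"
    unfolding p33_gf_mult by simp
  then have "cong5 (sec 5 1 (euler\<^sup>2 * ?H)) (sec 5 1 (p33_gf * dil 5 euler))"
    by (rule cong5_sec)
  also have "sec 5 1 (p33_gf * dil 5 euler) = ?S * euler"
    by (rule sec_mult_dil) simp
  finally have 3: "cong5 (?S * euler) (sec 5 1 (euler\<^sup>2 * ?H))"
    by (rule cong5_sym)
  have "cong5 (?S * euler + sec 5 0 (2 * (euler * ?H)) * dil 5 euler)
      (sec 5 1 (euler\<^sup>2 * ?H) + sec 5 0 (2 * A * ?H) * dil 5 euler)"
    by (intro cong5_add cong5_mult cong5_refl 3 cong5_sym[OF 2])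
  also note 1
  finally have "cong5 (2 * (?S * euler + sec 5 0 (2 * (euler * ?H)) * dil 5 euler)) (2 * 0)"
    by (intro cong5_mult cong5_refl)
  moreover have "2 * (?S * euler + sec 5 0 (2 * (euler * ?H)) * dil 5 euler) =
      2 * ?S * euler + 4 * sec 5 0 (euler * ?H) * dil 5 euler"
  proof -
    have "sec 5 0 (2 * (euler * ?H)) = 2 * sec 5 0 (euler * ?H)"
      by (rule fps_ext) (simp add: fps_numeral_mult_nth)
    then show ?thesis
      by algebra
  qed
  ultimately have 4: "cong5 (2 * ?S * euler + 4 * sec 5 0 (euler * ?H) * dil 5 euler) 0"
    by (simp only: mult_zero_right)
  have "cong5 (2 * ?S * euler + 2 * (euler * theta 1 psi) * dil 5 euler)
      (2 * ?S * euler + 4 * sec 5 0 (euler * ?H) * dil 5 euler)"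
    by (intro cong5_add cong5_mult cong5_refl cong5_sym[OF sec_euler_dil_euler_cube])
  also note 4
  finally have "cong5 (2 * ?S * euler) (- (2 * theta 1 psi * dil 5 euler) * euler)"
    unfolding cong5_def by (simp add: algebra_simps)
  then show ?thesis
    by (rule cong5_cancel[rotated]) simp
qed

text \<open>The factor in $q^5$ preserves residue classes modulo 5, so the support of
  \<open>theta 1 psi\<close> decides.\<close>

lemma p33_dvd_25:
  assumes "m mod 5 \<noteq> 0" "m mod 5 \<noteq> 2"
  shows "5 dvd p33 (5 * m + 1)"
proof -
  have "supp_mod 5 5 {0, 2} (2 * theta 1 psi * dil 5 euler)"
    by (rule supp_mod_mult[OF supp_mod_cmult[OF theta_psi_supp] supp_mod_dil]) auto
  then have "5 dvd fps_nth (2 * theta 1 psi * dil 5 euler) m"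
    by (rule supp_modD) (use assms in simp)
  moreover have "5 dvd fps_nth (2 * sec 5 1 p33_gf) m - fps_nth (- (2 * theta 1 psi * dil 5 euler)) m"
    by (rule cong5_nth[OF sec_p33_gf])
  ultimately have "5 dvd fps_nth (2 * sec 5 1 p33_gf) m"
    by (simp only: fps_neg_nth diff_minus_eq_add dvd_add_left_iff)
  then have "5 dvd 2 * int (p33 (5 * m + 1))"
    by (simp add: fps_numeral_mult_nth p33_gf_def)
  then show ?thesis
    by presburger
qed

lemma p33_dvd_15: "5 dvd p33 (15 * n + 6)"
proof -
  let ?S = "sec 5 1 p33_gf" and ?P = "theta 1 psi" and ?K = "theta 3 kappa"
  let ?Q = "theta 3 psi" and ?W = "theta 3 (\<lambda>y. if 3 dvd y then chi4 y * y else 0)"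
  have Q: "supp_mod 0 3 {0} ?Q"
    by (rule theta_3_psi_supp)
  have W: "supp_mod 0 3 {1} ?W"
    by (rule theta_3_rest_supp)
  have QQ: "supp_mod 0 3 {0} (?Q * ?Q)"
    by (rule supp_mod_mult[OF Q Q]) auto
  have QQQ: "supp_mod 0 3 {0} (?Q * ?Q * ?Q)"
    by (rule supp_mod_mult[OF QQ Q]) auto
  have WW: "supp_mod 0 3 {2} (?W * ?W)"
    by (rule supp_mod_mult[OF W W]) auto
  have WWQ: "supp_mod 0 3 {2} (?W * ?W * ?Q)"
    by (rule supp_mod_mult[OF WW Q]) auto
  have WWW: "supp_mod 0 3 {0} (?W * ?W * ?W)"
    by (rule supp_mod_mult[OF WW W]) auto
  \<comment> \<open>This is $- (Q + W)^2 (Q - 2 W)$ in the doubled series. The terms in $Q^2 W$, the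
    only ones of class 1 modulo 3, cancel.\<close>
  define R where "R = - (?Q * ?Q * ?Q) + (3 * (?W * ?W * ?Q) + 2 * (?W * ?W * ?W))"
  have R: "supp_mod 0 3 {0, 2} R"
    unfolding R_def
    by (rule supp_mod_add[OF supp_mod_minus[OF QQQ] supp_mod_add[OF supp_mod_cmult[OF WWQ] supp_mod_cmult[OF WWW] order_refl]]) auto
  have "cong5 (2 * ?S * (2 * dil 3 euler)) (- (2 * ?P * dil 5 euler) * (2 * dil 3 euler))"
    by (intro cong5_mult cong5_refl sec_p33_gf)
  also have "- (2 * ?P * dil 5 euler) * (2 * dil 3 euler) = - 2 * dil 5 euler * (2 * dil 3 euler * ?P)"
    by algebra
  also have "\<dots> = - 2 * dil 5 euler * (2 * euler * ?K)"
    unfolding dil_euler_theta_psi ..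
  finally have "cong5 (2 * ?S * (2 * dil 3 euler)) (- 2 * dil 5 euler * (2 * euler * ?K))" .
  also have "cong5 (- 2 * dil 5 euler * (2 * euler * ?K)) (- 2 * euler ^ 5 * (2 * euler * ?K))"
    by (intro cong5_mult cong5_refl cong5_sym[OF euler_power_5])
  also have "- 2 * euler ^ 5 * (2 * euler * ?K) = - ((2 * euler ^ 3)\<^sup>2 * ?K)"
    by algebra
  also have "\<dots> = R"
    unfolding theta_cube_split theta_kappa R_def by algebra
  finally have "cong5 (sec 3 1 (2 * ?S * (2 * dil 3 euler))) (sec 3 1 R)"
    by (rule cong5_sec)
  also have "sec 3 1 R = 0"
    by (rule fps_ext) (use supp_modD[OF R] in \<open>simp add: mod_mult_self3\<close>)
  \<comment> \<open>The factor $f_3$ is a series in $q^3$, so it leaves the extraction as $f$, which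
    can be cancelled.\<close>
  also have "sec 3 1 (2 * ?S * (2 * dil 3 euler)) = sec 3 1 (4 * ?S) * euler"
  proof -
    have "2 * ?S * (2 * dil 3 euler) = 4 * ?S * dil 3 euler"
      by simp
    then show ?thesis
      by (simp only: sec_mult_dil one_less_numeral_iff semiring_norm)
  qed
  finally have "cong5 (sec 3 1 (4 * ?S) * euler) (0 * euler)"
    by simp
  then have "cong5 (sec 3 1 (4 * ?S)) 0"
    by (rule cong5_cancel[rotated]) simp
  then have "5 dvd fps_nth (sec 3 1 (4 * ?S)) n - fps_nth 0 n"
    by (rule cong5_nth)
  then have "5 dvd 4 * int (p33 (5 * (3 * n + 1) + 1))"
    by (simp add: fps_numeral_mult_nth p33_gf_def)
  moreover have "5 * (3 * n + 1) + 1 = 15 * n + 6"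
    by simp
  ultimately have "5 dvd 4 * int (p33 (15 * n + 6))"
    by (simp only:)
  then show ?thesis
    by presburger
qed

theorem theorem1p2:
  fixes n :: nat
  shows "[p33 (15 * n + 6) = 0] (mod 5) \<and>
         [p33 (25 * n + 6) = 0] (mod 5) \<and>
         [p33 (25 * n + 16) = 0] (mod 5) \<and>
         [p33 (25 * n + 21) = 0] (mod 5)"
proof -
  have "25 * n + 6 = 5 * (5 * n + 1) + 1" "25 * n + 16 = 5 * (5 * n + 3) + 1"
    "25 * n + 21 = 5 * (5 * n + 4) + 1"
    by simp_all
  moreover have "5 dvd p33 (5 * (5 * n + 1) + 1)" "5 dvd p33 (5 * (5 * n + 3) + 1)"
    "5 dvd p33 (5 * (5 * n + 4) + 1)"
    by (rule p33_dvd_25; presburger)+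
  ultimately show ?thesis
    using p33_dvd_15[of n] by (simp only: cong_0_iff simp_thms)
qed

end
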